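(* Let $\mathbf{\Sigma}$ be a nice topological pointclass, and assume that $\mathsf{Det}(\mathbf{\Sigma}(\omega^\omega))$ holds. Let $\mathbf{\Gamma}\subseteq\mathbf{\Sigma}(\omega^\omega)$ be a good Wadge class in $\omega^\omega$ that is closed under squares and closed under $\mathsf{SU}_1$. Then there exists a filter (on $\omega$) of exact complexity $\mathbf{\Gamma}$.
   Context: Work in $\mathsf{ZF}+\mathsf{DC}$. "Space" means separable metrizable topological space. A space is zero-dimensional if it is non-empty and has a base of clopen sets. A filter (on $\omega$) is a collection $\mathcal{F}\subseteq\mathcal{P}(\omega)$ such that $\varnothing\notin\mathcal{F}$, $\omega\in\mathcal{F}$, $\mathcal{F}$ is closed under finite modifications (if $x\in\mathcal{F}$ and $x\Delta y$ is finite then $y\in\mathcal{F}$), upward-closed, and closed under finite intersections. It is given the subspace topology from $2^\omega$ (identifying subsets of $\omega$ with characteristic functions). Determinacy: a set $S\subseteq\omega^\omega$ is determined if one of the players has a winning strategy in the game where I and II alternately play $x_0,y_0,x_1,y_1,\ldots\in\omega$ and I wins iff $(x_0,y_0,x_1,y_1,\ldots)\in S$. $\mathsf{Det}(\mathcal{S})$ means every element of $\mathcal{S}\subseteq\mathcal{P}(\omega^\omega)$ is determined. Pointclasses: a topological pointclass is a function $\mathbf{\Sigma}$ assigning to each space $Z$ a collection $\mathbf{\Sigma}(Z)\subseteq\mathcal{P}(Z)$ such that $f^{-1}[B]\in\mathbf{\Sigma}(Z)$ whenever $f:Z\to W$ is continuous and $B\in\mathbf{\Sigma}(W)$. A Borel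 space is a space homeomorphic to a Borel subset of a Polish space. $\mathbf{\Sigma}$ is nice if moreover, for every space $Z$: every Borel subset of $Z$ is in $\mathbf{\Sigma}(Z)$; $\mathbf{\Sigma}(Z)$ is a Boolean subalgebra of $\mathcal{P}(Z)$; $f^{-1}[B]\in\mathbf{\Sigma}(Z)$ whenever $f:Z\to W$ is a Borel function and $B\in\mathbf{\Sigma}(W)$; and if $j[Z]\in\mathbf{\Sigma}(W)$ for some Borel space $W$ and embedding $j:Z\to W$, then $i[Z]\in\mathbf{\Sigma}(W)$ for every Borel space $W$ and embedding $i:Z\to W$. Wadge classes: for $\mathbf{\Gamma}\subseteq\mathcal{P}(Z)$, the dual is $\check{\mathbf{\Gamma}}=\{Z\setminus A:A\in\mathbf{\Gamma}\}$; $\mathbf{\Gamma}$ is selfdual if $\mathbf{\Gamma}=\check{\mathbf{\Gamma}}$; $\Delta(\mathbf{\Gamma})=\mathbf{\Gamma}\cap\check{\mathbf{\Gamma}}$. For $A\subseteq Z$ put $A{\downarrow}=\{f^{-1}[A]:f:Z\to Z\text{ continuous}\}$. A Wadge class in $Z$ is a collection of the form $A{\downarrow}$. Level: $\ell(\mathbf{\Gamma})\geq 1$ means $\mathsf{PU}_1(\mathbf{\Gamma})=\mathbf{\Gamma}$, where $\mathsf{PU}_1(\mathbf{\Gamma})$ is the collection of all sets $\bigcup_{n\in\omega}(A_n\cap V_n)$ with $A_n\in\mathbf{\Gamma}$ and $V_n\in\mathbf{\Delta}^0_2(Z)$ pairwise disjoint with $\bigcup_n V_n=Z$. Differences: for $1\leq\eta<\omega_1$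 and sets $(A_\mu:\mu<\eta)$, $\mathsf{D}_\eta(A_\mu:\mu<\eta)$ is the union of the sets $A_\mu\setminus\bigcup_{\zeta<\mu}A_\zeta$ over all $\mu<\eta$ whose parity is opposite to that of $\eta$ (limit ordinals and $0$ are even). $\mathsf{D}_\eta(\mathbf{\Sigma}^0_\xi(Z))$ is the collection of all such sets with each $A_\mu\in\mathbf{\Sigma}^0_\xi(Z)$. Good classes: a Wadge class $\mathbf{\Gamma}$ in $Z$ is good if it is non-selfdual, $\Delta(\mathsf{D}_\omega(\mathbf{\Sigma}^0_2(Z)))\subseteq\mathbf{\Gamma}$, and $\ell(\mathbf{\Gamma})\geq 1$. Closure under $\mathsf{SU}_1$: $\mathbf{\Gamma}\subseteq\mathcal{P}(Z)$ is closed under $\mathsf{SU}_1$ if $\mathsf{SU}_1(\mathbf{\Gamma})=\mathbf{\Gamma}$, where $\mathsf{SU}_1(\mathbf{\Gamma})$ is the collection of all sets $\bigcup_{n\in\omega}(A_n\cap U_n)$ with each $A_n\in\mathbf{\Gamma}$ and the $U_n\in\mathbf{\Sigma}^0_2(Z)$ pairwise disjoint. Exact complexity: for a good Wadge class $\mathbf{\Gamma}$ in $\omega^\omega$, a zero-dimensional space $X$ has exact complexity $\mathbf{\Gamma}$ if there is an embedding $j:X\to\omega^\omega$ with $j[X]{\downarrow}=\mathbf{\Gamma}$. Relativization and squares: for $\mathbf{\Gamma}\subseteq\mathcal{P}(\omega^\omega)$ and a space $Z$, $\mathbf{\Gamma}(Z)=\{A\subseteq Z:f^{-1}[A]\in\mathbf{\Gamma}\text{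 for every continuous }f:\omega^\omega\to Z\}$ (for Wadge classes, $\mathbf{\Gamma}(\omega^\omega)=\mathbf{\Gamma}$). $\mathbf{\Gamma}(Z)$ is closed under squares if $A\times A\in\mathbf{\Gamma}(Z\times Z)$ for every $A\in\mathbf{\Gamma}(Z)$; a Wadge class $\mathbf{\Gamma}$ in $\omega^\omega$ is closed under squares if this holds for $Z=\omega^\omega$. *)

theory Defs
  imports "HOL-Analysis.Analysis"
begin

section \<open>Spaces\<close>

definition sm_space :: "'a topology \<Rightarrow> bool" where
  "sm_space Z \<longleftrightarrow> separable_space Z \<and> metrizable_space Z"

definition zero_dimensional :: "'a topology \<Rightarrow> bool" where
  "zero_dimensional Z \<longleftrightarrow>
     sm_space Z \<and> topspace Z \<noteq> {} \<and>
     (\<exists>\<B>. (\<forall>U\<in>\<B>. openin Z U \<and> closedin Z U) \<and>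
          openin Z = arbitrary union_of (\<lambda>U. U \<in> \<B>))"

abbreviation preim :: "'a topology \<Rightarrow> ('a \<Rightarrow> 'b) \<Rightarrow> 'b set \<Rightarrow> 'a set" where
  "preim Z f B \<equiv> {x \<in> topspace Z. f x \<in> B}"

definition baire :: "(nat \<Rightarrow> nat) topology" where
  "baire = product_topology (\<lambda>_. discrete_topology UNIV) UNIV"

definition cantor :: "(nat \<Rightarrow> bool) topology" where
  "cantor = product_topology (\<lambda>_. discrete_topology UNIV) UNIV"

definition borel_algebra :: "'a topology \<Rightarrow> 'a measure" where
  "borel_algebra Z = sigma (topspace Z) {U. openin Z U}"

abbreviation borel_sets :: "'a topology \<Rightarrow> 'a set set" where
  "borel_sets Z \<equiv> sets (borel_algebra Z)"

definition sigma02 :: "'a topology \<Rightarrow> 'a set set" where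
  "sigma02 Z = {A. fsigma_in Z A}"

definition delta02 :: "'a topology \<Rightarrow> 'a set set" where
  "delta02 Z = {A. fsigma_in Z A \<and> gdelta_in Z A}"


section \<open>Topological pointclasses\<close>

text \<open>
  A pointclass is a function on the class of all separable metrizable spaces. Every such space
  has at most the cardinality of the continuum, so it is homeomorphic to a space whose underlying
  set is a subset of the type \<^typ>\<open>nat \<Rightarrow> nat\<close>, carrying an arbitrary separable metrizable topology
  (in general unrelated to the product topology on that type). Pointclasses are invariant
  under homeomorphisms, hence they are determined by, and can be freely prescribed on, the
  spaces over this type. Values at topologies that are not separable metrizable are junk.
\<close>

type_synonym uspace = "(nat \<Rightarrow> nat) topology"
type_synonym pointclass = "uspace \<Rightarrow> (nat \<Rightarrow> nat) set set"

definition topological_pointclass :: "pointclass \<Rightarrow> bool" where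
  "topological_pointclass \<Sigma> \<longleftrightarrow>
     (\<forall>Z. sm_space Z \<longrightarrow> \<Sigma> Z \<subseteq> Pow (topspace Z)) \<and>
     (\<forall>Z W f B. sm_space Z \<longrightarrow> sm_space W \<longrightarrow> continuous_map Z W f \<longrightarrow> B \<in> \<Sigma> W \<longrightarrow>
        preim Z f B \<in> \<Sigma> Z)"

definition borel_space :: "uspace \<Rightarrow> bool" where
  "borel_space W \<longleftrightarrow>
     (\<exists>P :: uspace. \<exists>B. separable_space P \<and> completely_metrizable_space P \<and>
        B \<in> borel_sets P \<and> W homeomorphic_space subtopology P B)"

definition nice_pointclass :: "pointclass \<Rightarrow> bool" where
  "nice_pointclass \<Sigma> \<longleftrightarrow>
     topological_pointclass \<Sigma> \<and>
     (\<forall>Z. sm_space Z \<longrightarrow>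
        borel_sets Z \<subseteq> \<Sigma> Z \<and>
        algebra (topspace Z) (\<Sigma> Z) \<and>
        (\<forall>W f B. sm_space W \<longrightarrow> f \<in> borel_algebra Z \<rightarrow>\<^sub>M borel_algebra W \<longrightarrow> B \<in> \<Sigma> W \<longrightarrow>
           preim Z f B \<in> \<Sigma> Z) \<and>
        ((\<exists>W j. borel_space W \<and> embedding_map Z W j \<and> j ` topspace Z \<in> \<Sigma> W) \<longrightarrow>
         (\<forall>W i. borel_space W \<longrightarrow> embedding_map Z W i \<longrightarrow> i ` topspace Z \<in> \<Sigma> W)))"


section \<open>Determinacy\<close>

text \<open>
  A run of the game is a single sequence \<open>z\<close>; player I chooses the entries with even index and
  player II those with odd index. A strategy maps the finite list of all previous moves to
  the next move.
\<close>

definition wins_I :: "(nat list \<Rightarrow> nat) \<Rightarrow> (nat \<Rightarrow> nat) set \<Rightarrow> bool" where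
  "wins_I \<sigma> S \<longleftrightarrow> (\<forall>z. (\<forall>n. even n \<longrightarrow> z n = \<sigma> (map z [0..<n])) \<longrightarrow> z \<in> S)"

definition wins_II :: "(nat list \<Rightarrow> nat) \<Rightarrow> (nat \<Rightarrow> nat) set \<Rightarrow> bool" where
  "wins_II \<tau> S \<longleftrightarrow> (\<forall>z. (\<forall>n. odd n \<longrightarrow> z n = \<tau> (map z [0..<n])) \<longrightarrow> z \<notin> S)"

definition determined :: "(nat \<Rightarrow> nat) set \<Rightarrow> bool" where
  "determined S \<longleftrightarrow> (\<exists>\<sigma>. wins_I \<sigma> S) \<or> (\<exists>\<tau>. wins_II \<tau> S)"

definition Det :: "(nat \<Rightarrow> nat) set set \<Rightarrow> bool" where
  "Det \<S> \<longleftrightarrow> (\<forall>S\<in>\<S>. determined S)"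


section \<open>Wadge classes\<close>

definition dual_class :: "'a topology \<Rightarrow> 'a set set \<Rightarrow> 'a set set" where
  "dual_class Z \<Gamma> = {topspace Z - A | A. A \<in> \<Gamma>}"

definition selfdual :: "'a topology \<Rightarrow> 'a set set \<Rightarrow> bool" where
  "selfdual Z \<Gamma> \<longleftrightarrow> \<Gamma> = dual_class Z \<Gamma>"

definition ambiguous :: "'a topology \<Rightarrow> 'a set set \<Rightarrow> 'a set set" where
  "ambiguous Z \<Gamma> = \<Gamma> \<inter> dual_class Z \<Gamma>"

definition wadge_down :: "'a topology \<Rightarrow> 'a set \<Rightarrow> 'a set set" where
  "wadge_down Z A = {preim Z f A | f. continuous_map Z Z f}"

definition wadge_class :: "'a topology \<Rightarrow> 'a set set \<Rightarrow> bool" where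
  "wadge_class Z \<Gamma> \<longleftrightarrow> (\<exists>A \<subseteq> topspace Z. \<Gamma> = wadge_down Z A)"

definition PU1 :: "'a topology \<Rightarrow> 'a set set \<Rightarrow> 'a set set" where
  "PU1 Z \<Gamma> = {\<Union>n. A n \<inter> V n | A V :: nat \<Rightarrow> 'a set.
     range A \<subseteq> \<Gamma> \<and> range V \<subseteq> delta02 Z \<and> disjoint_family V \<and> (\<Union>n. V n) = topspace Z}"

definition SU1 :: "'a topology \<Rightarrow> 'a set set \<Rightarrow> 'a set set" where
  "SU1 Z \<Gamma> = {\<Union>n. A n \<inter> U n | A U :: nat \<Rightarrow> 'a set.
     range A \<subseteq> \<Gamma> \<and> range U \<subseteq> sigma02 Z \<and> disjoint_family U}"

definition level_ge_1 :: "'a topology \<Rightarrow> 'a set set \<Rightarrow> bool" where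
  "level_ge_1 Z \<Gamma> \<longleftrightarrow> PU1 Z \<Gamma> = \<Gamma>"

definition closed_under_SU1 :: "'a topology \<Rightarrow> 'a set set \<Rightarrow> bool" where
  "closed_under_SU1 Z \<Gamma> \<longleftrightarrow> SU1 Z \<Gamma> = \<Gamma>"

text \<open>
  The difference operation of length \<open>\<omega>\<close>: being a limit, \<open>\<omega>\<close> is even, so the indices that
  contribute are the odd ones.
\<close>

definition D_omega :: "(nat \<Rightarrow> 'a set) \<Rightarrow> 'a set" where
  "D_omega A = (\<Union>m\<in>{m. odd m}. A m - (\<Union>k<m. A k))"

definition D_omega_sigma02 :: "'a topology \<Rightarrow> 'a set set" where
  "D_omega_sigma02 Z = {D_omega A | A. range A \<subseteq> sigma02 Z}"

definition good_wadge_class :: "'a topology \<Rightarrow> 'a set set \<Rightarrow> bool" where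
  "good_wadge_class Z \<Gamma> \<longleftrightarrow>
     wadge_class Z \<Gamma> \<and> \<not> selfdual Z \<Gamma> \<and>
     ambiguous Z (D_omega_sigma02 Z) \<subseteq> \<Gamma> \<and> level_ge_1 Z \<Gamma>"

definition relativize :: "(nat \<Rightarrow> nat) set set \<Rightarrow> 'a topology \<Rightarrow> 'a set set" where
  "relativize \<Gamma> Z =
     {A. A \<subseteq> topspace Z \<and> (\<forall>f. continuous_map baire Z f \<longrightarrow> preim baire f A \<in> \<Gamma>)}"

definition closed_under_squares :: "(nat \<Rightarrow> nat) set set \<Rightarrow> 'a topology \<Rightarrow> bool" where
  "closed_under_squares \<Gamma> Z \<longleftrightarrow>
     (\<forall>A \<in> relativize \<Gamma> Z. A \<times> A \<in> relativize \<Gamma> (prod_topology Z Z))"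

definition has_exact_complexity :: "'a topology \<Rightarrow> (nat \<Rightarrow> nat) set set \<Rightarrow> bool" where
  "has_exact_complexity X \<Gamma> \<longleftrightarrow>
     zero_dimensional X \<and>
     (\<exists>j. embedding_map X baire j \<and> wadge_down baire (j ` topspace X) = \<Gamma>)"


section \<open>Filters on the natural numbers\<close>

text \<open>
  The library type of filters is not used, as it admits the improper filter and filters that are
  not closed under finite modifications.
\<close>

definition omega_filter :: "nat set set \<Rightarrow> bool" where
  "omega_filter \<F> \<longleftrightarrow>
     {} \<notin> \<F> \<and> UNIV \<in> \<F> \<and>
     (\<forall>x y. x \<in> \<F> \<longrightarrow> finite (sym_diff x y) \<longrightarrow> y \<in> \<F>) \<and>
     (\<forall>x y. x \<in> \<F> \<longrightarrow> x \<subseteq> y \<longrightarrow> y \<in> \<F>) \<and>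
     (\<forall>x y. x \<in> \<F> \<longrightarrow> y \<in> \<F> \<longrightarrow> x \<inter> y \<in> \<F>)"

text \<open>
  The map sending a set to its characteristic function is injective, so the pullback along it is
  the subspace topology inherited from the Cantor space.
\<close>

definition filter_space :: "nat set set \<Rightarrow> nat set topology" where
  "filter_space \<F> = pullback_topology \<F> (\<lambda>x n. n \<in> x) cantor"

end

theory Submission
  imports Defs "HOL-Library.Sublist"
begin

text \<open>
  Write \<open>\<Gamma>\<close> as the class of sets reducible to \<open>X\<close>. Code the finite sequences by natural numbers, so
  that every \<open>x\<close> in the Baire space has an infinite set of initial segments, its branch, and let the
  dual ideal of the filter be generated by the finite sets and the branches of the points of \<open>X\<close>.
  Mapping \<open>x\<close> to its branch reduces \<open>X\<close> to the ideal. Conversely, the sets in the ideal are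
  covered by countably many closed sets, each of which consists of sets splitting, up to a fixed finite
  set, into finitely many linearly ordered pieces with prescribed stems. Thus by \<open>SU1\<close> and
  closure under intersections it suffices to treat linearly ordered sets \<open>A\<close>, which are in the ideal iff \<open>A\<close> is finite
  or its limit is in \<open>X\<close>. The limit is a continuous function on a \<open>G\<^sub>\<delta>\<close> set; a Wadge game turns it into a total
  reduction, and it remains to see that \<open>\<Gamma>\<close> is closed under unions with \<open>F\<^sub>\<sigma>\<close> sets.

  For the latter, choose a Wadge minimal \<open>Y\<close> such that \<open>X\<close> is obtained from \<open>Y\<close> by continuous preimages
  on \<open>G\<^sub>\<delta>\<close> sets and Boolean operations with \<open>G\<^sub>\<delta>\<close> sets. A selfdual \<open>Y\<close> could be split into smaller sets, hence \<open>Y\<close>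
  is not selfdual; and if the class of \<open>Y\<close> or its dual were not closed under intersections with \<open>G\<^sub>\<delta>\<close> sets,
  then \<open>Y\<close> would be selfdual relative to some \<open>G\<^sub>\<delta>\<close> set, which again gives a smaller set. So \<open>X\<close> is equivalent to \<open>Y\<close> or to
  its complement, and inherits the closure properties. The minimum exists by the Martin--Monk theorem.
\<close>

section \<open>Topology of the Baire space in terms of finite agreement\<close>

section \<open>The Baire space\<close>

definition agree :: "nat \<Rightarrow> (nat \<Rightarrow> 'a) \<Rightarrow> (nat \<Rightarrow> 'a) \<Rightarrow> bool" where
  "agree n x y \<longleftrightarrow> (\<forall>i<n. x i = y i)"

lemma agree_refl [simp]: "agree n x x"
  by (simp add: agree_def)

lemma agree_sym: "agree n x y \<Longrightarrow> agree n y x"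
  by (simp add: agree_def)

lemma agree_trans: "agree n x y \<Longrightarrow> agree n y z \<Longrightarrow> agree n x z"
  by (simp add: agree_def)

lemma agree_mono: "agree n x y \<Longrightarrow> m \<le> n \<Longrightarrow> agree m x y"
  by (simp add: agree_def)

lemma map_upt_eq_iff_agree: "map x [0..<n] = map y [0..<n] \<longleftrightarrow> agree n x y"
  by (auto simp: agree_def)

text \<open>Identifies the space of the statement with the type class topology, so that
  \<open>open\<close>, \<open>continuous_on\<close> and \<open>borel\<close> apply to it.\<close>

lemma baire_eq_euclidean: "baire = euclidean"
proof -
  have "(discrete_topology UNIV :: nat topology) = euclidean"
    unfolding topology_eq by (auto simp: open_discrete)
  then show ?thesis
    by (simp add: baire_def euclidean_product_topology)
qed

lemma open_seq_iff:
  fixes U :: "(nat \<Rightarrow> nat) set"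
  shows "open U \<longleftrightarrow> (\<forall>x\<in>U. \<exists>n. \<forall>y. agree n x y \<longrightarrow> y \<in> U)"
proof
  assume U: "open U"
  show "\<forall>x\<in>U. \<exists>n. \<forall>y. agree n x y \<longrightarrow> y \<in> U"
  proof
    fix x assume "x \<in> U"
    with U obtain X where X: "x \<in> Pi\<^sub>E UNIV X" "finite {i. X i \<noteq> UNIV}" "Pi\<^sub>E UNIV X \<subseteq> U"
      using product_topology_open_contains_basis[of "\<lambda>_. euclidean" UNIV U x]
      unfolding open_fun_def topspace_euclidean by blast
    then obtain n where n: "\<forall>i\<in>{i. X i \<noteq> UNIV}. i < n"
      unfolding finite_nat_set_iff_bounded by blast
    have "y \<in> U" if y: "agree n x y" for y
    proof -
      have "y i \<in> X i" for i
      proof (cases "X i = UNIV")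
        case False
        then have "y i = x i" using n y by (simp add: agree_def)
        then show ?thesis using X(1) by (simp add: PiE_iff)
      qed simp
      then have "y \<in> Pi\<^sub>E UNIV X" by (simp add: PiE_iff)
      then show ?thesis using X(3) by (rule subsetD[rotated])
    qed
    then show "\<exists>n. \<forall>y. agree n x y \<longrightarrow> y \<in> U" by blast
  qed
next
  assume R: "\<forall>x\<in>U. \<exists>n. \<forall>y. agree n x y \<longrightarrow> y \<in> U"
  have op: "open {y. agree n x y}" for n and x :: "nat \<Rightarrow> nat"
  proof -
    have "{y. agree n x y} = (\<Inter>i\<in>{..<n}. (\<lambda>y. y i) -` {x i})"
      by (auto simp: agree_def)
    moreover have "open ((\<lambda>y. y i) -` {x i})" for i
      by (rule open_vimage[OF open_discrete continuous_on_product_coordinates])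
    ultimately show ?thesis by (simp add: open_INT)
  qed
  have "\<exists>T. open T \<and> x \<in> T \<and> T \<subseteq> U" if "x \<in> U" for x
  proof -
    from bspec[OF R that] obtain n where "\<forall>y. agree n x y \<longrightarrow> y \<in> U" ..
    then show ?thesis
      using op[of n x] by (intro exI[of _ "{y. agree n x y}"]) auto
  qed
  then show "open U" by (simp add: open_subopen[of U])
qed

lemma open_agree: "open {y :: nat \<Rightarrow> nat. agree n x y}"
  unfolding open_seq_iff using agree_trans by blast

lemma closed_seq_iff:
  fixes C :: "(nat \<Rightarrow> nat) set"
  shows "closed C \<longleftrightarrow> (\<forall>x. x \<notin> C \<longrightarrow> (\<exists>n. \<forall>y. agree n x y \<longrightarrow> y \<notin> C))"
  by (auto simp: closed_def open_seq_iff)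

lemma open_seqE:
  fixes U :: "(nat \<Rightarrow> nat) set"
  assumes "open U" "x \<in> U"
  obtains n where "\<And>y. agree n x y \<Longrightarrow> y \<in> U"
proof -
  from assms have "\<exists>n. \<forall>y. agree n x y \<longrightarrow> y \<in> U" by (simp add: open_seq_iff)
  then obtain n where "\<forall>y. agree n x y \<longrightarrow> y \<in> U" ..
  then show ?thesis using that[of n] by simp
qed

lemma closed_seqE:
  fixes C :: "(nat \<Rightarrow> nat) set"
  assumes "closed C" "x \<notin> C"
  obtains n where "\<And>y. agree n x y \<Longrightarrow> y \<notin> C"
  using open_seqE[of "- C" x] assms by (metis ComplD ComplI open_Compl)

text \<open>Finitely many coordinates have finitely many moduli, and the largest serves all of them.
  The set \<open>G\<close> allows for partial functions.\<close>

lemma agree_modulus: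
  assumes "\<And>j. \<exists>n. \<forall>y\<in>G. agree n x y \<longrightarrow> f y j = f x j"
  shows "\<exists>n. \<forall>y\<in>G. agree n x y \<longrightarrow> agree m (f x) (f y)"
proof (induction m)
  case 0 then show ?case by (simp add: agree_def)
next
  case (Suc m)
  then obtain n where n: "\<forall>y\<in>G. agree n x y \<longrightarrow> agree m (f x) (f y)" by blast
  obtain n' where n': "\<forall>y\<in>G. agree n' x y \<longrightarrow> f y m = f x m" using assms by blast
  have "agree (Suc m) (f x) (f y)" if "y \<in> G" "agree (max n n') x y" for y
  proof -
    have "agree m (f x) (f y)" "f y m = f x m"
      using n n' that agree_mono[OF that(2)] by auto
    then show ?thesis by (auto simp: agree_def less_Suc_eq)
  qed
  then show ?case by blast
qed

lemma continuous_on_seq_iff: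
  fixes f :: "(nat \<Rightarrow> nat) \<Rightarrow> nat \<Rightarrow> nat"
  shows "continuous_on G f \<longleftrightarrow> (\<forall>x\<in>G. \<forall>j. \<exists>n. \<forall>y\<in>G. agree n x y \<longrightarrow> f y j = f x j)"
proof
  assume f: "continuous_on G f"
  show "\<forall>x\<in>G. \<forall>j. \<exists>n. \<forall>y\<in>G. agree n x y \<longrightarrow> f y j = f x j"
  proof (intro ballI allI)
    fix x j assume x: "x \<in> G"
    obtain A where A: "open A" "A \<inter> G = f -` {z. agree (Suc j) (f x) z} \<inter> G"
      using f[unfolded continuous_on_open_invariant, rule_format, OF open_agree[of "Suc j" "f x"]]
      by blast
    have "x \<in> f -` {z. agree (Suc j) (f x) z} \<inter> G" using x by simp
    then have "x \<in> A" unfolding A(2)[symmetric] by blast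
    with A(1) obtain n where "\<forall>y. agree n x y \<longrightarrow> y \<in> A"
      unfolding open_seq_iff by (elim ballE exE) blast+
    then show "\<exists>n. \<forall>y\<in>G. agree n x y \<longrightarrow> f y j = f x j"
    proof (intro exI ballI impI)
      fix y assume "y \<in> G" "agree n x y"
      then have "y \<in> f -` {z. agree (Suc j) (f x) z} \<inter> G"
        using A(2) \<open>\<forall>y. agree n x y \<longrightarrow> y \<in> A\<close> by blast
      then show "f y j = f x j" by (simp add: agree_def)
    qed
  qed
next
  assume f: "\<forall>x\<in>G. \<forall>j. \<exists>n. \<forall>y\<in>G. agree n x y \<longrightarrow> f y j = f x j"
  have ag: "\<exists>n. \<forall>y\<in>G. agree n x y \<longrightarrow> agree m (f x) (f y)" if "x \<in> G" for x m
    using f that by (intro agree_modulus) auto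
  show "continuous_on G f"
    unfolding continuous_on_open_invariant
  proof (intro allI impI)
    fix B :: "(nat \<Rightarrow> nat) set" assume B: "open B"
    let ?A = "{x. \<exists>y\<in>G. \<exists>n. agree n y x \<and> (\<forall>z\<in>G. agree n y z \<longrightarrow> f z \<in> B)}"
    have "open ?A"
      unfolding open_seq_iff using agree_trans by blast
    moreover have "?A \<inter> G = f -` B \<inter> G"
    proof -
      have "\<exists>n. \<forall>z\<in>G. agree n y z \<longrightarrow> f z \<in> B" if "y \<in> G" "f y \<in> B" for y
      proof -
        obtain m where "\<forall>w. agree m (f y) w \<longrightarrow> w \<in> B" using B \<open>f y \<in> B\<close> open_seq_iff by blast
        then show ?thesis using ag[OF \<open>y \<in> G\<close>, of m] by blast
      qed
      moreover have "f y \<in> B" if "agree n x y" "y \<in> G" "\<forall>z\<in>G. agree n x z \<longrightarrow> f z \<in> B" for n x y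
        using that by blast
      ultimately show ?thesis using agree_refl by blast
    qed
    ultimately show "\<exists>A. open A \<and> A \<inter> G = f -` B \<inter> G" by blast
  qed
qed

lemma continuous_on_seq_agree:
  fixes f :: "(nat \<Rightarrow> nat) \<Rightarrow> nat \<Rightarrow> nat"
  assumes "continuous_on G f" "x \<in> G"
  shows "\<exists>n. \<forall>y\<in>G. agree n x y \<longrightarrow> agree m (f x) (f y)"
  using assms by (intro agree_modulus) (auto simp: continuous_on_seq_iff)

lemma continuous_map_baire_iff: "continuous_map baire baire f \<longleftrightarrow> continuous_on UNIV f"
  by (simp add: baire_eq_euclidean)

section \<open>G-delta and F-sigma sets of the Baire space\<close>

abbreviation gdel :: "(nat \<Rightarrow> nat) set \<Rightarrow> bool" where "gdel \<equiv> gdelta_in euclidean"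
abbreviation fsig :: "(nat \<Rightarrow> nat) set \<Rightarrow> bool" where "fsig \<equiv> fsigma_in euclidean"

lemma gdel_iff: "gdel G \<longleftrightarrow> (\<exists>U. (\<forall>n::nat. open (U n)) \<and> G = (\<Inter>n. U n))"
proof
  assume "gdel G"
  then obtain U where "\<forall>n::nat. open (U n)" "\<Inter>(range U) = G"
    unfolding gdelta_in_descending open_openin[symmetric] by blast
  then show "\<exists>U. (\<forall>n::nat. open (U n)) \<and> G = (\<Inter>n. U n)" by blast
next
  assume "\<exists>U. (\<forall>n::nat. open (U n)) \<and> G = (\<Inter>n. U n)"
  then obtain U where U: "\<forall>n::nat. open (U n)" "G = (\<Inter>n. U n)" by blast
  have "gdel (\<Inter>(range U))"
    by (rule gdelta_in_Inter) (use U in \<open>auto intro: open_imp_gdelta_in\<close>)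
  then show "gdel G" using U by simp
qed

lemma gdel_Compl: "gdel (- G) \<longleftrightarrow> fsig G"
  by (simp add: fsigma_in_gdelta_in Compl_eq_Diff_UNIV)

lemma fsig_Compl: "fsig (- G) \<longleftrightarrow> gdel G"
  by (simp add: gdelta_in_fsigma_in Compl_eq_Diff_UNIV)

lemma fsig_iff: "fsig G \<longleftrightarrow> (\<exists>C. (\<forall>n::nat. closed (C n)) \<and> G = (\<Union>n. C n))"
proof
  assume "fsig G"
  then obtain C where "\<forall>n::nat. closed (C n)" "\<Union>(range C) = G"
    unfolding fsigma_in_ascending closed_closedin[symmetric] by blast
  then show "\<exists>C. (\<forall>n::nat. closed (C n)) \<and> G = (\<Union>n. C n)" by blast
next
  assume "\<exists>C. (\<forall>n::nat. closed (C n)) \<and> G = (\<Union>n. C n)"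
  then obtain C where C: "\<forall>n::nat. closed (C n)" "G = (\<Union>n. C n)" by blast
  have "fsig (\<Union>(range C))"
    by (rule fsigma_in_Union) (use C in \<open>auto intro: closed_imp_fsigma_in\<close>)
  then show "fsig G" using C by simp
qed

text \<open>A closed set is the intersection of its open neighbourhoods formed by the points that
  agree up to \<open>n\<close> with a point of \<open>C\<close>.\<close>

lemma closed_imp_gdel:
  fixes C :: "(nat \<Rightarrow> nat) set" assumes "closed C" shows "gdel C"
proof -
  let ?U = "\<lambda>n. \<Union>x\<in>C. {y. agree n x y}"
  have "C = (\<Inter>n. ?U n)"
  proof (intro equalityI subsetI)
    fix y assume "y \<in> (\<Inter>n. ?U n)"
    then have "\<exists>x\<in>C. agree n x y" for n by blast
    then show "y \<in> C" using assms agree_sym unfolding closed_seq_iff by blast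
  qed (use agree_refl in blast)
  moreover have "open (?U n)" for n by (intro open_UN ballI open_agree)
  ultimately show ?thesis unfolding gdel_iff by (intro exI[of _ ?U]) auto
qed

lemma open_imp_gdel: "open U \<Longrightarrow> gdel U"
  by (simp add: open_imp_gdelta_in)

lemma closed_imp_fsig: "closed C \<Longrightarrow> fsig C"
  by (simp add: closed_imp_fsigma_in)

lemma open_imp_fsig: "open U \<Longrightarrow> fsig U"
  using closed_imp_gdel[of "- U"] by (simp add: gdel_Compl closed_Compl)

text \<open>Relatively open preimages extend to open sets of the whole space; cutting back to the
  domain keeps the intersection G-delta.\<close>

lemma gdel_vimage_on:
  assumes "continuous_on G k" "gdel G" "gdel H"
  shows "gdel {z\<in>G. k z \<in> H}"
proof -
  obtain U where U: "\<And>n::nat. open (U n)" "H = (\<Inter>n. U n)" using assms(3) gdel_iff by blast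
  have "\<forall>n. \<exists>A. open A \<and> A \<inter> G = k -` U n \<inter> G"
    using assms(1) U(1) unfolding continuous_on_open_invariant by blast
  then obtain A where A: "\<And>n. open (A n)" "\<And>n. A n \<inter> G = k -` U n \<inter> G" by metis
  have "{z\<in>G. k z \<in> H} = G \<inter> (\<Inter>n. A n)" using A(2) U(2) by blast
  moreover have "gdel (\<Inter>n. A n)" using A(1) gdel_iff by blast
  ultimately show ?thesis using assms(2) by (simp add: gdelta_in_Int)
qed

lemma gdel_vimage: "continuous_on UNIV k \<Longrightarrow> gdel H \<Longrightarrow> gdel (k -` H)"
  using gdel_vimage_on[of UNIV k H] by (simp add: vimage_def open_imp_gdel)

lemma gdel_borel: "gdel G \<Longrightarrow> G \<in> sets borel"
  by (auto simp: gdel_iff)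

section \<open>Infinite games, and strategies as continuous maps\<close>

section \<open>Games\<close>

text \<open>The maps given by strategies of the player who moves first: output entry
  \<open>n\<close> is fixed before input entry \<open>n\<close> is read.\<close>

definition contraction :: "((nat \<Rightarrow> nat) \<Rightarrow> nat \<Rightarrow> nat) \<Rightarrow> bool" where
  "contraction g \<longleftrightarrow> (\<forall>n x y. agree n x y \<longrightarrow> agree (Suc n) (g x) (g y))"

lemma contraction_continuous:
  assumes "contraction g" shows "continuous_on UNIV g"
  unfolding continuous_on_seq_iff
proof (intro ballI allI)
  fix x j
  have "g y j = g x j" if "agree j x y" for y
    using assms that unfolding contraction_def agree_def by (metis lessI)
  then show "\<exists>n. \<forall>y\<in>UNIV. agree n x y \<longrightarrow> g y j = g x j" by blast
qed

text \<open>\<open>p\<close> selects the player who follows \<open>\<sigma>\<close>: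
  \<open>True\<close> for the even positions, \<open>False\<close> for the odd ones. The opponent's
  moves are read off \<open>z\<close> in order.\<close>

fun play :: "bool \<Rightarrow> (nat list \<Rightarrow> nat) \<Rightarrow> (nat \<Rightarrow> nat) \<Rightarrow> nat \<Rightarrow> nat" where
  "play p \<sigma> z n = (if even n = p then \<sigma> (map (play p \<sigma> z) [0..<n]) else z (n div 2))"

declare play.simps [simp del]

lemma play_agree: "agree n y z \<Longrightarrow> agree (2 * n) (play p \<sigma> y) (play p \<sigma> z)"
proof -
  assume yz: "agree n y z"
  have "k < 2 * n \<longrightarrow> play p \<sigma> y k = play p \<sigma> z k" for k
  proof (induction k rule: less_induct)
    case (less k)
    show ?case
    proof
      assume k: "k < 2 * n"
      have "map (play p \<sigma> y) [0..<k] = map (play p \<sigma> z) [0..<k]"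
        using less k by simp
      moreover have "y (k div 2) = z (k div 2)" using yz k by (simp add: agree_def)
      ultimately show "play p \<sigma> y k = play p \<sigma> z k"
        by (simp only: play.simps[of p \<sigma> y k] play.simps[of p \<sigma> z k])
    qed
  qed
  then show ?thesis by (simp add: agree_def)
qed

abbreviation (input) evens :: "(nat \<Rightarrow> nat) \<Rightarrow> nat \<Rightarrow> nat" where "evens w \<equiv> (\<lambda>n. w (2 * n))"
abbreviation (input) odds :: "(nat \<Rightarrow> nat) \<Rightarrow> nat \<Rightarrow> nat" where "odds w \<equiv> (\<lambda>n. w (Suc (2 * n)))"

text \<open>What the argument uses of the pointclass on the Baire space. Borel preimages serve for
  continuous maps that are defined on a G-delta set only.\<close>

locale det_sets =
  fixes S :: "(nat \<Rightarrow> nat) set set"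
  assumes Compl: "A \<in> S \<Longrightarrow> - A \<in> S"
    and Int: "A \<in> S \<Longrightarrow> B \<in> S \<Longrightarrow> A \<inter> B \<in> S"
    and borel: "A \<in> sets borel \<Longrightarrow> A \<in> S"
    and borel_vimage: "f \<in> borel_measurable borel \<Longrightarrow> A \<in> S \<Longrightarrow> f -` A \<in> S"
    and determined: "A \<in> S \<Longrightarrow> determined A"
begin

lemma vimage: "continuous_on UNIV f \<Longrightarrow> A \<in> S \<Longrightarrow> f -` A \<in> S"
  by (intro borel_vimage borel_measurable_continuous_onI)

lemma Un: "A \<in> S \<Longrightarrow> B \<in> S \<Longrightarrow> A \<union> B \<in> S"
  using Compl[OF Int[OF Compl Compl]] by simp

text \<open>The players build \<open>y\<close> in the even and \<open>z\<close> in the odd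
  positions, and the second player wins iff \<open>(y, z) \<in> R\<close>. A winning strategy of the
  second player is a continuous map; one of the first player is a contraction, as that player is one
  move ahead.\<close>

lemma game_dichotomy:
  assumes S: "{w. (evens w, odds w) \<notin> R} \<in> S"
  obtains f where "continuous_on UNIV f" "\<And>y. (y, f y) \<in> R"
  | g where "contraction g" "\<And>z. (g z, z) \<notin> R"
proof -
  from determined[OF S] consider \<sigma> where "wins_I \<sigma> {w. (evens w, odds w) \<notin> R}"
    | \<tau> where "wins_II \<tau> {w. (evens w, odds w) \<notin> R}"
    unfolding determined_def by blast
  then show ?thesis
  proof cases
    case 1
    let ?g = "\<lambda>z. evens (play True \<sigma> z)"
    have "contraction ?g"
      unfolding contraction_def
    proof (intro allI impI)
      fix n x y assume "agree n (x :: nat \<Rightarrow> nat) y"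
      then have a: "agree (2 * n) (play True \<sigma> x) (play True \<sigma> y)" by (rule play_agree)
      then have "play True \<sigma> x (2 * n) = play True \<sigma> y (2 * n)"
        unfolding map_upt_eq_iff_agree[symmetric]
        by (simp add: play.simps[of True \<sigma> x "2 * n"] play.simps[of True \<sigma> y "2 * n"]
            del: map_eq_conv)
      then show "agree (Suc n) (?g x) (?g y)"
        using a by (auto simp: agree_def less_Suc_eq)
    qed
    moreover have "(?g z, z) \<notin> R" for z
    proof -
      have "play True \<sigma> z \<in> {w. (evens w, odds w) \<notin> R}"
        by (rule 1[unfolded wins_I_def, rule_format], subst play.simps) simp
      moreover have "odds (play True \<sigma> z) = z" by (simp add: play.simps)
      ultimately show ?thesis by simp
    qed
    ultimately show ?thesis by (rule that(2))
  next
    case 2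
    let ?f = "\<lambda>z. odds (play False \<tau> z)"
    have "continuous_on UNIV ?f"
      unfolding continuous_on_seq_iff
    proof (intro ballI allI)
      fix x j
      have "?f y j = ?f x j" if "agree (Suc j) x y" for y
        using play_agree[OF that, of False \<tau>] by (simp add: agree_def)
      then show "\<exists>n. \<forall>y\<in>UNIV. agree n x y \<longrightarrow> ?f y j = ?f x j" by blast
    qed
    moreover have "(z, ?f z) \<in> R" for z
    proof -
      have "play False \<tau> z \<notin> {w. (evens w, odds w) \<notin> R}"
        by (rule 2[unfolded wins_II_def, rule_format], subst play.simps) simp
      moreover have "evens (play False \<tau> z) = z" by (simp add: play.simps)
      ultimately show ?thesis by simp
    qed
    ultimately show ?thesis by (rule that(1))
  qed
qed

end

lemma continuous_reindex: "continuous_on UNIV (\<lambda>(x :: nat \<Rightarrow> nat) (n :: nat). x (r n))"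
  unfolding continuous_on_seq_iff
proof (intro ballI allI)
  fix x :: "nat \<Rightarrow> nat" and j
  have "y (r j) = x (r j)" if "agree (Suc (r j)) x y" for y using that by (simp add: agree_def)
  then show "\<exists>n. \<forall>y\<in>UNIV. agree n x y \<longrightarrow> y (r j) = x (r j)" by blast
qed

section \<open>Flip sets of bit sequences are not determined\<close>

section \<open>Flip sets\<close>

text \<open>A move is read as a nonempty string of bits; the default \<open>[False]\<close> replaces
  the empty string, so that every run yields infinitely many bits.\<close>

definition block :: "nat \<Rightarrow> bool list" where
  "block k = (let l = from_nat k in if l = [] then [False] else l)"

text \<open>Since blocks are nonempty, the first \<open>Suc m\<close> moves already contain bit
  \<open>m\<close>.\<close>

definition run_bits :: "(nat \<Rightarrow> nat) \<Rightarrow> nat \<Rightarrow> bool" where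
  "run_bits w m = concat (map block (map w [0..<Suc m])) ! m"

lemma block_to_nat: "l \<noteq> [] \<Longrightarrow> block (to_nat l) = l"
  by (simp add: block_def)

lemma length_concat_block: "length l \<le> length (concat (map block l))"
proof (induction l)
  case (Cons k l)
  have "block k \<noteq> []" by (simp add: block_def Let_def)
  then have "1 \<le> length (block k)" by (simp add: Suc_le_eq)
  then show ?case using Cons by simp
qed simp

lemma run_bits_nth:
  assumes "m < length (concat (map block (map w [0..<n])))"
  shows "run_bits w m = concat (map block (map w [0..<n])) ! m"
proof -
  let ?c = "\<lambda>n. concat (map block (map w [0..<n]))"
  have mono: "?c j ! m = ?c i ! m" if "i \<le> j" "m < length (?c i)" for i j
  proof -
    have "[0..<j] = [0..<i] @ [i..<j]" using that(1) upt_add_eq_append[of 0 i "j - i"] by simp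
    then show ?thesis using that(2) by (simp add: nth_append)
  qed
  have "m < length (?c (Suc m))"
    using length_concat_block[of "map w [0..<Suc m]"] by simp
  then show ?thesis
    using mono[of "Suc m" n] mono[of n "Suc m"] assms by (cases "Suc m \<le> n") (auto simp: run_bits_def)
qed

definition extend :: "nat list \<Rightarrow> (nat \<Rightarrow> nat) \<Rightarrow> nat \<Rightarrow> nat" where
  "extend l e i = (if i < length l then l ! i else e (i - length l))"

lemma map_extend: "map (extend l e) [0..<length l + n] = l @ map e [0..<n]"
  by (rule nth_equalityI) (auto simp: extend_def nth_append)

text \<open>
  Both runs follow the same strategy: each answer of the strategy in one run is the next move
  against it in the other run, so that the two runs end up one bit apart.
\<close>

function answers :: "(nat list \<Rightarrow> nat) \<Rightarrow> nat list \<Rightarrow> nat \<Rightarrow> nat" where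
  "answers \<sigma> l n = (if even n
     then \<sigma> (l @ [to_nat [False]] @ map (answers \<sigma> l) [0..<n])
     else \<sigma> (l @ [to_nat (True # block (answers \<sigma> l 0))] @ map (answers \<sigma> l) [1..<n]))"
  by pat_completeness auto
termination
  by (relation "Wellfounded.measure (\<lambda>(\<sigma>, l, n). n)") (auto elim: oddE)

declare answers.simps [simp del]

text \<open>After \<open>l\<close> the opponent plays \<open>[False]\<close> in run
  \<open>a\<close>, and \<open>True\<close> followed by the first answer of \<open>a\<close> in run
  \<open>b\<close>; then the answers are copied across. Both bit sequences consist of the bits of
  \<open>l\<close>, one differing bit and the same tail.\<close>

lemma two_runs:
  fixes \<sigma> l
  defines "e \<equiv> answers \<sigma> l"
  defines "a \<equiv> extend (l @ [to_nat [False]]) e"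
    and "b \<equiv> extend (l @ [to_nat (True # block (e 0))]) (\<lambda>i. e (Suc i))"
  assumes par: "even (length l) \<longleftrightarrow> \<not> p"
    and init: "\<And>i. i < length l \<Longrightarrow> even i = p \<Longrightarrow> l ! i = \<sigma> (take i l)"
  shows "even i = p \<Longrightarrow> a i = \<sigma> (map a [0..<i])" "even i = p \<Longrightarrow> b i = \<sigma> (map b [0..<i])"
    "\<exists>k. run_bits a k \<noteq> run_bits b k \<and> (\<forall>i. i \<noteq> k \<longrightarrow> run_bits a i = run_bits b i)"
proof -
  \<comment> \<open>Before the deviation a run follows \<open>l\<close>, and position
    \<open>length l\<close> belongs to the opponent by \<open>par\<close>.\<close>
  have pre: "extend (l @ [c]) f i = \<sigma> (map (extend (l @ [c]) f) [0..<i])"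
    if "even i = p" "i < Suc (length l)" for c f i
  proof -
    have "i \<noteq> length l" using par that(1) by auto
    then have i: "i < length l" using that(2) by simp
    moreover have "map (extend (l @ [c]) f) [0..<i] = take i l"
      using i by (intro nth_equalityI) (auto simp: extend_def nth_append)
    ultimately show ?thesis using init[OF i that(1)] by (simp add: extend_def nth_append)
  qed
  show "a i = \<sigma> (map a [0..<i])" if i: "even i = p"
  proof (cases "i < Suc (length l)")
    case False
    then obtain n where n: "i = Suc (length l) + n"
      using le_iff_add[of "Suc (length l)" i] by (auto simp: not_less)
    then have "even n" using i par by auto
    have "map a [0..<i] = l @ [to_nat [False]] @ map e [0..<n]"
      using map_extend[of "l @ [to_nat [False]]" e n] n by (simp add: a_def del: upt_Suc)
    then have "e n = \<sigma> (map a [0..<i])"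
      using \<open>even n\<close> by (simp add: e_def answers.simps[of \<sigma> l n])
    then show ?thesis using n by (simp add: a_def extend_def del: upt_Suc)
  qed (simp only: a_def pre[OF i])
  show "b i = \<sigma> (map b [0..<i])" if i: "even i = p"
  proof (cases "i < Suc (length l)")
    case False
    then obtain n where n: "i = Suc (length l) + n"
      using le_iff_add[of "Suc (length l)" i] by (auto simp: not_less)
    then have ev: "even n" using i par by auto
    have "map (\<lambda>i. e (Suc i)) [0..<n] = map e [1..<Suc n]"
      by (intro nth_equalityI) (auto simp del: upt_Suc)
    then have "map b [0..<i] = l @ [to_nat (True # block (e 0))] @ map e [1..<Suc n]"
      using map_extend[of "l @ [to_nat (True # block (e 0))]" "\<lambda>i. e (Suc i)" n] n
      by (simp add: b_def del: upt_Suc)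
    then have "e (Suc n) = \<sigma> (map b [0..<i])"
      using ev by (simp add: e_def answers.simps[of \<sigma> l "Suc n"] del: upt_Suc)
    then show ?thesis using n by (simp add: b_def extend_def del: upt_Suc)
  qed (simp only: b_def pre[OF i])
  define L where "L = concat (map block l)"
  define E where "E n = concat (map block (map e [0..<n]))" for n
  \<comment> \<open>Run \<open>a\<close> needs one move more than run \<open>b\<close> for the same
    tail, since the deviating move of \<open>b\<close> already contains
    \<open>block (e 0)\<close>.\<close>
  have A: "concat (map block (map a [0..<length l + 1 + Suc n])) = L @ [False] @ E (Suc n)" for n
    using map_extend[of "l @ [to_nat [False]]" e "Suc n"]
    by (simp add: a_def L_def E_def block_to_nat del: upt_Suc)
  have B: "concat (map block (map b [0..<length l + 1 + n])) = L @ [True] @ E (Suc n)" for n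
  proof -
    have "map (\<lambda>i. e (Suc i)) [0..<n] = map e [1..<Suc n]"
      by (intro nth_equalityI) (auto simp del: upt_Suc)
    moreover have "[0..<Suc n] = 0 # [1..<Suc n]" using upt_conv_Cons[of 0 "Suc n"] by simp
    ultimately show ?thesis
      using map_extend[of "l @ [to_nat (True # block (e 0))]" "\<lambda>i. e (Suc i)" n]
      by (simp add: b_def L_def E_def block_to_nat del: upt_Suc)
  qed
  have len: "n \<le> length (E n)" for n
    using length_concat_block[of "map e [0..<n]"] by (simp add: E_def)
  have ma: "run_bits a m = (L @ [False] @ E (Suc m)) ! m" for m
    using run_bits_nth[of m a "length l + 1 + Suc m"] len[of "Suc m"] unfolding A by simp
  have mb: "run_bits b m = (L @ [True] @ E (Suc m)) ! m" for m
    using run_bits_nth[of m b "length l + 1 + m"] len[of "Suc m"] unfolding B by simp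
  have "run_bits a (length L) \<noteq> run_bits b (length L)" by (simp add: ma mb)
  moreover have "run_bits a i = run_bits b i" if "i \<noteq> length L" for i
    using that by (simp add: ma mb nth_append nth_Cons' )
  ultimately show "\<exists>k. run_bits a k \<noteq> run_bits b k \<and> (\<forall>i. i \<noteq> k \<longrightarrow> run_bits a i = run_bits b i)" by blast
qed

text \<open>A winning strategy would put both runs of \<open>two_runs\<close> on the same side of
  \<open>B\<close>, although their bits differ in exactly one place.\<close>

lemma determined_not_flip:
  assumes "determined {w. run_bits w \<in> B}"
    and flip: "\<And>x y k. x k \<noteq> y k \<Longrightarrow> (\<And>i. i \<noteq> k \<Longrightarrow> x i = y i) \<Longrightarrow> x \<in> B \<longleftrightarrow> y \<notin> B"
  shows False
proof -
  consider \<sigma> where "wins_I \<sigma> {w. run_bits w \<in> B}" | \<tau> where "wins_II \<tau> {w. run_bits w \<in> B}"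
    using assms(1) unfolding determined_def by blast
  then show False
  proof cases
    case 1
    \<comment> \<open>The first player opens the game, so the common start consists of the move
      \<open>\<sigma> []\<close>.\<close>
    define a where "a = extend [\<sigma> [], to_nat [False]] (answers \<sigma> [\<sigma> []])"
    define b where "b = extend [\<sigma> [], to_nat (True # block (answers \<sigma> [\<sigma> []] 0))]
      (\<lambda>i. answers \<sigma> [\<sigma> []] (Suc i))"
    note runs = two_runs[of "[\<sigma> []]" True \<sigma>, simplified, folded a_def b_def]
    have "run_bits a \<in> B" "run_bits b \<in> B"
      using 1 runs(1,2) unfolding wins_I_def by blast+
    then show False using runs(3) flip by blast
  next
    case 2
    define a where "a = extend [to_nat [False]] (answers \<tau> [])"
    define b where "b = extend [to_nat (True # block (answers \<tau> [] 0))] (\<lambda>i. answers \<tau> [] (Suc i))"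
    note runs = two_runs[of "[]" False \<tau>, simplified, folded a_def b_def]
    have "run_bits a \<notin> B" "run_bits b \<notin> B"
      using 2 runs(1,2) unfolding wins_II_def by blast+
    then show False using runs(3) flip by blast
  qed
qed

section \<open>Wadge's lemma and the Martin-Monk theorem\<close>

section \<open>The Wadge order\<close>

definition wadge_le :: "(nat \<Rightarrow> nat) set \<Rightarrow> (nat \<Rightarrow> nat) set \<Rightarrow> bool" (infix "\<le>\<^sub>W" 50) where
  "A \<le>\<^sub>W B \<longleftrightarrow> (\<exists>f. continuous_on UNIV f \<and> A = f -` B)"

lemma wadge_le_vimage: "continuous_on UNIV f \<Longrightarrow> f -` B \<le>\<^sub>W B"
  unfolding wadge_le_def by blast

lemma wadge_le_refl: "A \<le>\<^sub>W A"
  using wadge_le_vimage[OF continuous_on_id, of A] by simp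

lemma wadge_le_trans: "A \<le>\<^sub>W B \<Longrightarrow> B \<le>\<^sub>W C \<Longrightarrow> A \<le>\<^sub>W C"
  unfolding wadge_le_def
  by (metis continuous_on_compose continuous_on_subset subset_UNIV vimage_comp)

lemma wadge_le_Compl: "- A \<le>\<^sub>W - B \<longleftrightarrow> A \<le>\<^sub>W B"
  unfolding wadge_le_def by (metis double_compl vimage_Compl)

lemma wadge_le_Compl_swap: "- A \<le>\<^sub>W B \<longleftrightarrow> A \<le>\<^sub>W - B"
  using wadge_le_Compl[of A "- B"] by simp

text \<open>The composite of \<open>m\<close> maps with index \<open>i\<close> outermost; bit
  \<open>x j\<close> selects which of two maps is used at index \<open>j\<close>.\<close>

fun compose_from :: "(nat \<Rightarrow> bool \<Rightarrow> 'a \<Rightarrow> 'a) \<Rightarrow> (nat \<Rightarrow> bool) \<Rightarrow> nat \<Rightarrow> nat \<Rightarrow> 'a \<Rightarrow> 'a" where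
  "compose_from \<rho> x i 0 y = y"
| "compose_from \<rho> x i (Suc m) y = \<rho> i (x i) (compose_from \<rho> x (Suc i) m y)"

lemma compose_from_add: "compose_from \<rho> x i (m + k) y = compose_from \<rho> x i m (compose_from \<rho> x (i + m) k y)"
  by (induction m arbitrary: i) auto

lemma compose_from_cong: "(\<And>j. i \<le> j \<Longrightarrow> j < i + m \<Longrightarrow> x j = x' j) \<Longrightarrow> compose_from \<rho> x i m y = compose_from \<rho> x' i m y"
  by (induction m arbitrary: i) auto

context det_sets
begin

text \<open>The Martin-Monk argument: by \<open>conv\<close> the infinite composites
  \<open>z x i\<close> exist, and each map exchanges membership precisely when its bit is set.
  Membership of \<open>z x 0\<close> in \<open>A 0\<close> thus defines a flip set of bit sequences
  whose preimage under \<open>run_bits\<close> is determined.\<close>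

lemma no_flip_sequence:
  assumes A: "A 0 \<in> S"
    and cont: "\<And>n b. continuous_on UNIV (\<rho> n b)"
    and flip: "\<And>n b y. \<rho> n b y \<in> A n \<longleftrightarrow> (y \<in> A (Suc n)) \<noteq> b"
    and conv: "\<And>i j. \<exists>m. \<forall>x y y'. compose_from \<rho> x i m y j = compose_from \<rho> x i m y' j"
  shows False
proof -
  obtain M where M: "\<And>i j x y y'. compose_from \<rho> x i (M i j) y j = compose_from \<rho> x i (M i j) y' j"
    using conv by metis
  define z where "z x i j = compose_from \<rho> x i (M i j) (\<lambda>_. 0) j" for x i j
  have z: "compose_from \<rho> x i m y j = z x i j" if "M i j \<le> m" for x i m y j
  proof -
    have "compose_from \<rho> x i m y j = compose_from \<rho> x i (M i j) (compose_from \<rho> x (i + M i j) (m - M i j) y) j"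
      using compose_from_add[of \<rho> x i "M i j" "m - M i j" y] that by simp
    also have "\<dots> = z x i j" unfolding z_def by (rule M)
    finally show ?thesis .
  qed
  have step: "z x i = \<rho> i (x i) (z x (Suc i))" for x i
  proof
    fix j
    let ?w = "z x (Suc i)"
    obtain N where N: "\<forall>w\<in>UNIV. agree N ?w w \<longrightarrow> \<rho> i (x i) w j = \<rho> i (x i) ?w j"
      using cont[of i "x i", unfolded continuous_on_seq_iff] by blast
    \<comment> \<open>After \<open>m\<close> maps, entry \<open>j\<close> of the composite from
      \<open>i\<close> and the first \<open>N\<close> entries of the one from \<open>Suc i\<close>
      are stable, so continuity of a single map passes to the limit.\<close>
    define m where "m = Max (insert (M i j) (M (Suc i) ` {..<N}))"
    have m: "M i j \<le> m" "\<And>j'. j' < N \<Longrightarrow> M (Suc i) j' \<le> m" by (auto simp: m_def)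
    let ?v = "compose_from \<rho> x (Suc i) m (\<lambda>_. 0)"
    have "agree N ?w ?v" using z m(2) by (simp add: agree_def)
    then have "\<rho> i (x i) ?v j = \<rho> i (x i) ?w j" using N by blast
    moreover have "\<rho> i (x i) ?v j = z x i j" using z[of i j "Suc m" x "\<lambda>_. 0"] m(1) by simp
    ultimately show "z x i j = \<rho> i (x i) ?w j" by simp
  qed
  have z_cong: "z x i = z x' i" if "\<And>j. i \<le> j \<Longrightarrow> x j = x' j" for x x' i
  proof
    fix j
    have "compose_from \<rho> x i (M i j) (\<lambda>_. 0) = compose_from \<rho> x' i (M i j) (\<lambda>_. 0)"
      by (rule compose_from_cong) (rule that)
    then show "z x i j = z x' i j" by (simp add: z_def)
  qed
  define B where "B = {x. z x 0 \<in> A 0}"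
  have "continuous_on UNIV (\<lambda>w. z (run_bits w) 0)"
    unfolding continuous_on_seq_iff
  proof (intro ballI allI)
    fix w j
    have "z (run_bits v) 0 j = z (run_bits w) 0 j" if v: "agree (Suc (M 0 j)) w v" for v
    proof -
      have "run_bits v k = run_bits w k" if "k < M 0 j" for k
      proof -
        have "agree (Suc k) v w" using v that by (simp add: agree_def)
        then show ?thesis by (simp only: run_bits_def map_upt_eq_iff_agree[symmetric])
      qed
      then have "compose_from \<rho> (run_bits v) 0 (M 0 j) (\<lambda>_. 0) = compose_from \<rho> (run_bits w) 0 (M 0 j) (\<lambda>_. 0)"
        by (intro compose_from_cong) simp
      then show ?thesis by (simp only: z_def)
    qed
    then show "\<exists>n. \<forall>v\<in>UNIV. agree n w v \<longrightarrow> z (run_bits v) 0 j = z (run_bits w) 0 j" by blast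
  qed
  then have "(\<lambda>w. z (run_bits w) 0) -` A 0 \<in> S" using A by (rule vimage)
  then have B: "{w. run_bits w \<in> B} \<in> S" by (simp add: B_def vimage_def)
  \<comment> \<open>The tails beyond \<open>k\<close> have the same limit. Exactly one of the two
    maps at \<open>k\<close> flips membership, and the maps below \<open>k\<close>, being equal,
    carry the difference down to index 0.\<close>
  have flipB: "x \<in> B \<longleftrightarrow> x' \<notin> B" if k: "x k \<noteq> x' k" "\<And>i. i \<noteq> k \<Longrightarrow> x i = x' i" for x x' k
  proof -
    have "z x (Suc k) = z x' (Suc k)" using k(2) by (intro z_cong) auto
    then have base: "z x k \<in> A k \<longleftrightarrow> z x' k \<notin> A k" using step flip k(1) by metis
    have "z x (k - i) \<in> A (k - i) \<longleftrightarrow> z x' (k - i) \<notin> A (k - i)" if "i \<le> k" for i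
      using that
    proof (induction i)
      case 0 then show ?case using base by simp
    next
      case (Suc i)
      define n where "n = k - Suc i"
      have n: "k - i = Suc n" "n \<noteq> k" using Suc.prems by (auto simp: n_def)
      have "z x (Suc n) \<in> A (Suc n) \<longleftrightarrow> z x' (Suc n) \<notin> A (Suc n)" using Suc n by simp
      then have "z x n \<in> A n \<longleftrightarrow> z x' n \<notin> A n"
        unfolding step[of x n] step[of x' n] flip k(2)[OF n(2)] by blast
      then show ?case by (simp add: n_def)
    qed
    from this[of k] show ?thesis by (simp add: B_def)
  qed
  show False by (rule determined_not_flip[OF determined[OF B] flipB])
qed

text \<open>In the Wadge game the second player answers \<open>y\<close> with \<open>z\<close> such
  that \<open>y \<in> A \<longleftrightarrow> z \<in> B\<close>. Without a reduction of
  \<open>A\<close> to \<open>B\<close> the first player wins, and that strategy is a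
  contraction.\<close>

lemma wadge:
  assumes "A \<in> S" "B \<in> S" "\<not> A \<le>\<^sub>W B"
  obtains g where "contraction g" "g -` A = - B"
proof -
  let ?R = "{(y, z). y \<in> A \<longleftrightarrow> z \<in> B}"
  have "{w. (evens w, odds w) \<notin> ?R} = - ((evens -` A \<inter> odds -` B) \<union> (- (evens -` A) \<inter> - (odds -` B)))"
    by auto
  also have "\<dots> \<in> S"
    using assms(1,2) by (intro Compl Un Int vimage continuous_reindex)
  finally show ?thesis
  proof (cases rule: game_dichotomy)
    case (1 f)
    then have "A = f -` B" by auto
    then show ?thesis using 1(1) assms(3) unfolding wadge_le_def by blast
  next
    case (2 g)
    then have "g -` A = - B" by auto
    then show ?thesis using 2(1) that by blast
  qed
qed

lemma wadge_le_cases: "A \<in> S \<Longrightarrow> B \<in> S \<Longrightarrow> A \<le>\<^sub>W B \<or> - B \<le>\<^sub>W A"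
  by (metis wadge contraction_continuous wadge_le_def)

lemma contraction_compose_from:
  assumes "\<And>n b. contraction (\<rho> n b)"
  shows "agree m (compose_from \<rho> x i m y) (compose_from \<rho> x i m y')"
proof (induction m arbitrary: i)
  case (Suc m)
  then show ?case using assms unfolding contraction_def by simp
qed (simp add: agree_def)

text \<open>Otherwise Wadge's lemma, applied to \<open>A (Suc n)\<close> and to its complement,
  yields contractions with and without flip. Each contraction fixes one more entry, so the
  composites converge and form a flip sequence.\<close>

lemma wadge_wf:
  assumes S: "\<And>n. A n \<in> S"
  shows "\<exists>n. A n \<le>\<^sub>W A (Suc n) \<or> A n \<le>\<^sub>W - A (Suc n)"
proof (rule ccontr)
  assume "\<not> ?thesis"
  then have n: "\<not> A n \<le>\<^sub>W A (Suc n)" "\<not> A n \<le>\<^sub>W - A (Suc n)" for n by auto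
  have "\<exists>g. contraction g \<and> (\<forall>y. g y \<in> A n \<longleftrightarrow> (y \<in> A (Suc n)) \<noteq> b)" for n b
  proof (cases b)
    case True
    obtain g where "contraction g" "g -` A n = - A (Suc n)"
      using wadge[OF S S n(1)] by blast
    then show ?thesis using True by (intro exI[of _ g]) auto
  next
    case False
    obtain g where "contraction g" "g -` A n = - (- A (Suc n))"
      using wadge[OF S Compl[OF S] n(2)] by blast
    then show ?thesis using False by (intro exI[of _ g]) auto
  qed
  then obtain \<rho> where \<rho>: "\<And>n b. contraction (\<rho> n b)"
    "\<And>n b y. \<rho> n b y \<in> A n \<longleftrightarrow> (y \<in> A (Suc n)) \<noteq> b"
    by metis
  have "\<forall>x y y'. compose_from \<rho> x i (Suc j) y j = compose_from \<rho> x i (Suc j) y' j" for i j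
    using contraction_compose_from[of \<rho> "Suc j", OF \<rho>(1)] unfolding agree_def by blast
  then show False
    using no_flip_sequence[of A \<rho>, OF S contraction_continuous[OF \<rho>(1)] \<rho>(2)] by blast
qed

text \<open>Without a minimum, dependent choice produces a sequence contradicting
  \<open>wadge_wf\<close>.\<close>

lemma wadge_minimal:
  assumes "X \<in> S" "P X"
  obtains Y where "Y \<in> S" "P Y" "\<And>Z. Z \<in> S \<Longrightarrow> P Z \<Longrightarrow> Y \<le>\<^sub>W Z \<or> Y \<le>\<^sub>W - Z"
proof (rule ccontr)
  assume "\<not> thesis"
  then have "\<forall>Y. Y \<in> S \<and> P Y \<longrightarrow> (\<exists>Z. (Z \<in> S \<and> P Z) \<and> \<not> Y \<le>\<^sub>W Z \<and> \<not> Y \<le>\<^sub>W - Z)"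
    using that by blast
  then obtain A where "\<And>n. A n \<in> S \<and> P (A n)"
    "\<And>n. \<not> A n \<le>\<^sub>W A (Suc n) \<and> \<not> A n \<le>\<^sub>W - A (Suc n)"
    using dependent_nat_choice[of "\<lambda>_ Y. Y \<in> S \<and> P Y" "\<lambda>_ Y Z. \<not> Y \<le>\<^sub>W Z \<and> \<not> Y \<le>\<^sub>W - Z"] assms
    by blast
  then show False using wadge_wf[of A] by blast
qed

end

section \<open>Localizing a selfdual set near a point\<close>

definition section_at :: "(nat \<Rightarrow> nat) set \<Rightarrow> (nat \<Rightarrow> nat) \<Rightarrow> nat \<Rightarrow> (nat \<Rightarrow> nat) set" where
  "section_at Y z k = {y. (\<lambda>i. if i < k then z i else y (i - k)) \<in> Y}"

lemma continuous_prepend: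
  "continuous_on UNIV (\<lambda>(y :: nat \<Rightarrow> nat) i. if i < k then z i else y (i - k) :: nat)"
  unfolding continuous_on_seq_iff
proof (intro ballI allI)
  fix x :: "nat \<Rightarrow> nat" and j
  have "(if j < k then z j else y (j - k)) = (if j < k then z j else x (j - k))"
    if "agree (Suc j) x y" for y using that by (simp add: agree_def)
  then show "\<exists>n. \<forall>y\<in>UNIV. agree n x y \<longrightarrow>
    (if j < k then z j else y (j - k)) = (if j < k then z j else x (j - k))" by blast
qed

context det_sets
begin

lemma section_at_in: "Y \<in> S \<Longrightarrow> section_at Y z k \<in> S"
  using vimage[OF continuous_prepend] by (simp add: section_at_def vimage_def)

text \<open>
  Otherwise, the reductions of \<open>Y\<close> to arbitrarily small pieces of itself around \<open>z\<close>, with and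
  without flipping, would give a flip sequence. The pieces are chosen so small that
  the composites converge.
\<close>

lemma selfdual_section:
  assumes Y: "Y \<in> S" "Y \<le>\<^sub>W - Y"
  shows "\<exists>k. \<not> Y \<le>\<^sub>W section_at Y z k \<and> \<not> Y \<le>\<^sub>W - section_at Y z k"
proof (rule ccontr)
  assume neg: "\<not> ?thesis"
  obtain f where f: "continuous_on UNIV f" "Y = f -` (- Y)" using Y(2) wadge_le_def by blast
  have "- Y \<le>\<^sub>W Y" using Y(2) by (simp add: wadge_le_Compl_swap)
  \<comment> \<open>As \<open>Y\<close> is selfdual, a reduction to the complement of the section is
    as good as one to the section itself.\<close>
  have le: "Y \<le>\<^sub>W section_at Y z k" for k
  proof -
    have "- Y \<le>\<^sub>W section_at Y z k" if "Y \<le>\<^sub>W - section_at Y z k"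
      using that by (simp only: wadge_le_Compl_swap)
    then show ?thesis using neg wadge_le_trans[OF Y(2)] by blast
  qed
  \<comment> \<open>Prepending the first \<open>k\<close> entries of \<open>z\<close> yields
    reductions of \<open>Y\<close> to itself with values near \<open>z\<close>.\<close>
  have "\<exists>\<phi>. continuous_on UNIV \<phi> \<and> (\<forall>y. agree k z (\<phi> y)) \<and> (\<forall>y. \<phi> y \<in> Y \<longleftrightarrow> y \<in> Y)" for k
  proof -
    obtain g where g: "continuous_on UNIV g" "Y = g -` section_at Y z k"
      using le[of k] wadge_le_def by blast
    let ?p = "\<lambda>(y :: nat \<Rightarrow> nat) i. if i < k then z i else y (i - k)"
    have "continuous_on UNIV (?p \<circ> g)"
      by (rule continuous_on_compose[OF g(1) continuous_on_subset[OF continuous_prepend]]) simp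
    moreover have "agree k z (?p (g y))" for y by (simp add: agree_def)
    moreover have "?p (g y) \<in> Y \<longleftrightarrow> y \<in> Y" for y
      using g(2) by (auto simp: section_at_def)
    ultimately show ?thesis by (intro exI[of _ "?p \<circ> g"]) (simp add: o_def)
  qed
  then obtain \<phi> where \<phi>: "\<And>k. continuous_on UNIV (\<phi> k)" "\<And>k y. agree k z (\<phi> k y)"
    "\<And>k y. \<phi> k y \<in> Y \<longleftrightarrow> y \<in> Y"
    by metis
  \<comment> \<open>\<open>f\<close> reduces \<open>Y\<close> to its complement, so composing with
    it adds the flip.\<close>
  define \<psi> where "\<psi> k b = (if b then \<phi> k \<circ> f else \<phi> k)" for k b
  have \<psi>: "continuous_on UNIV (\<psi> k b)" "agree k z (\<psi> k b y)" "\<psi> k b y \<in> Y \<longleftrightarrow> (y \<in> Y) \<noteq> b" for k b y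
  proof -
    show "continuous_on UNIV (\<psi> k b)"
      using f(1) \<phi>(1) continuous_on_compose[of UNIV f "\<phi> k"] continuous_on_subset[of UNIV "\<phi> k" "range f"]
      by (simp add: \<psi>_def)
    have "f y \<in> Y \<longleftrightarrow> y \<notin> Y" using f(2) by blast
    then show "\<psi> k b y \<in> Y \<longleftrightarrow> (y \<in> Y) \<noteq> b" by (simp add: \<psi>_def \<phi>(3))
    show "agree k z (\<psi> k b y)" by (simp add: \<psi>_def \<phi>(2))
  qed
  define good where "good F n k \<longleftrightarrow> (\<forall>c\<in>F. \<forall>y. agree k z y \<longrightarrow> agree n (c z) (c y))"
    for F :: "((nat \<Rightarrow> nat) \<Rightarrow> nat \<Rightarrow> nat) set" and n k
  define K where "K F n = (SOME k. good F n k)" for F n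
  \<comment> \<open>\<open>F n\<close> collects the finitely many composites that may stand outside
    the map of index \<open>n\<close>, with \<open>id\<close> for the empty one. By finiteness one
    neighbourhood of \<open>z\<close>, given by \<open>K\<close>, suits all of them.\<close>
  define F where "F = rec_nat {id} (\<lambda>n F. insert id {c \<circ> \<psi> (K F n) b | c b. c \<in> F})"
  have F0: "F 0 = {id}" and FS: "F (Suc n) = insert id {c \<circ> \<psi> (K (F n) n) b | c b. c \<in> F n}" for n
    by (simp_all add: F_def)
  have fin: "finite (F n) \<and> (\<forall>c\<in>F n. continuous_on UNIV c)" for n
  proof (induction n)
    case 0 then show ?case by (simp add: F0 continuous_on_id)
  next
    case (Suc n)
    have "{c \<circ> \<psi> (K (F n) n) b | c b. c \<in> F n} = (\<lambda>(c, b). c \<circ> \<psi> (K (F n) n) b) ` (F n \<times> UNIV)"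
      by (auto simp: image_iff)
    then have "finite (F (Suc n))" using Suc by (simp add: FS)
    moreover have "continuous_on UNIV (c \<circ> \<psi> (K (F n) n) b)" if "c \<in> F n" for c b
      using Suc that \<psi>(1) by (blast intro: continuous_on_compose continuous_on_subset)
    ultimately show ?case by (auto simp: FS continuous_on_id)
  qed
  have "\<exists>k. good (F n) n k" for n
  proof -
    have "\<exists>k. \<forall>y. agree k z y \<longrightarrow> agree n (c z) (c y)" if "c \<in> F n" for c
      using continuous_on_seq_agree[of UNIV c z n] fin that by blast
    then obtain h where h: "\<And>c y. c \<in> F n \<Longrightarrow> agree (h c) z y \<Longrightarrow> agree n (c z) (c y)" by metis
    have "good (F n) n (Max (h ` F n))"
      unfolding good_def using fin h agree_mono by (metis Max_ge finite_imageI imageI)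
    then show ?thesis ..
  qed
  then have K: "good (F n) n (K (F n) n)" for n unfolding K_def by (rule someI_ex)
  define \<rho> where "\<rho> n = \<psi> (K (F n) n)" for n
  have "compose_from \<rho> x i m \<in> F (i + m)" for x i m
  proof (induction m)
    case 0
    have "compose_from \<rho> x i 0 = id" by auto
    then show ?case by (cases i) (auto simp: F0 FS)
  next
    case (Suc m)
    have "compose_from \<rho> x i (Suc m) = compose_from \<rho> x i m \<circ> \<rho> (i + m) (x (i + m))"
      using compose_from_add[of \<rho> x i m 1] by auto
    also have "\<dots> \<in> F (Suc (i + m))"
      unfolding FS \<rho>_def[symmetric] using Suc by blast
    finally show ?case by (simp only: add_Suc_right)
  qed
  \<comment> \<open>Whatever its argument, the map of index \<open>i + m\<close> has values so close
    to \<open>z\<close> that the composite outside it is fixed up to \<open>i + m\<close>.\<close>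
  then have "agree (i + m) (compose_from \<rho> x i m z) (compose_from \<rho> x i m (\<rho> (i + m) b y))" for x i m b y
    using K[of "i + m"] \<psi>(2)[of "K (F (i + m)) (i + m)" b y] unfolding good_def \<rho>_def by blast
  then have ag: "agree (i + m) (compose_from \<rho> x i m z) (compose_from \<rho> x i (Suc m) y)" for x i m y
    using compose_from_add[of \<rho> x i m 1 y] by simp
  have conv: "\<exists>m. \<forall>x y y'. compose_from \<rho> x i m y j = compose_from \<rho> x i m y' j" for i j
  proof (intro exI allI)
    fix x y y'
    show "compose_from \<rho> x i (Suc (Suc j)) y j = compose_from \<rho> x i (Suc (Suc j)) y' j"
      using ag[of i "Suc j" x y] ag[of i "Suc j" x y'] unfolding agree_def by simp
  qed
  show False
    by (rule no_flip_sequence[of "\<lambda>_. Y" \<rho>]) (use Y(1) conv \<psi>(1,3) in \<open>auto simp: \<rho>_def\<close>)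
qed

end

section \<open>Retractions onto closed and G-delta sets\<close>

section \<open>Sets obtained piecewise from another set\<close>

text \<open>Off \<open>F\<close>, take the longest initial segment of \<open>y\<close> that extends
  into \<open>F\<close> and replace \<open>y\<close> by a point of \<open>F\<close> chosen for that
  segment.\<close>

lemma closed_retract_seq:
  fixes F :: "(nat \<Rightarrow> nat) set"
  assumes F: "closed F" "F \<noteq> {}"
  obtains r where "continuous_on UNIV r" "\<And>y. r y \<in> F" "\<And>y. y \<in> F \<Longrightarrow> r y = y"
proof -
  define E where "E y l \<longleftrightarrow> (\<exists>x\<in>F. agree l y x)" for y l
  define L where "L y = (GREATEST l. E y l)" for y
  \<comment> \<open>The choice depends on the segment alone, which makes \<open>r\<close> locally
    constant off \<open>F\<close>.\<close>
  define p where "p t = (SOME x. x \<in> F \<and> map x [0..<length t] = t)" for t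
  define r where "r y = (if y \<in> F then y else p (map y [0..<L y]))" for y
  have E0: "E y 0" for y using F(2) by (auto simp: E_def agree_def)
  have Emono: "E y l'" if "E y l" "l' \<le> l" for y l l'
    using that agree_mono unfolding E_def by blast
  have bdd: "\<exists>n. \<forall>l. E y l \<longrightarrow> l < n" if y: "y \<notin> F" for y
  proof -
    obtain n where n: "\<And>x. agree n y x \<Longrightarrow> x \<notin> F" using closed_seqE[OF F(1) y] by metis
    have "l < n" if "E y l" for l
    proof (rule ccontr)
      assume "\<not> l < n"
      then have "E y n" using Emono that by simp
      then show False using n by (auto simp: E_def)
    qed
    then show ?thesis by blast
  qed
  have EL: "E y (L y)" and EL_max: "E y l \<Longrightarrow> l \<le> L y" if y: "y \<notin> F" for y l
  proof -
    obtain n where n: "\<forall>l. E y l \<longrightarrow> l < n" using bdd[OF y] by blast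
    then have n': "E y l \<Longrightarrow> l \<le> n" for l by (simp add: less_imp_le)
    show "E y (L y)" unfolding L_def by (rule GreatestI_nat[where P = "E y", OF E0 n'])
    show "E y l \<Longrightarrow> l \<le> L y" unfolding L_def by (rule Greatest_le_nat[where P = "E y", OF _ n'])
  qed
  have p: "r y \<in> F" "agree (L y) (r y) y" if "y \<notin> F" for y
  proof -
    have "\<exists>x. x \<in> F \<and> map x [0..<length (map y [0..<L y])] = map y [0..<L y]"
      using EL[OF that] unfolding E_def length_map length_upt diff_zero map_upt_eq_iff_agree
      by (blast intro: agree_sym)
    from someI_ex[OF this] have "r y \<in> F \<and> map (r y) [0..<L y] = map y [0..<L y]"
      using that by (simp add: r_def p_def)
    then show "r y \<in> F" "agree (L y) (r y) y" by (simp_all only: map_upt_eq_iff_agree)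
  qed
  have "continuous_on UNIV r"
    unfolding continuous_on_seq_iff
  proof (intro ballI allI)
    fix y j
    show "\<exists>n. \<forall>y'\<in>UNIV. agree n y y' \<longrightarrow> r y' j = r y j"
    proof (cases "y \<in> F")
      case True
      have "r y' j = r y j" if "agree (Suc j) y y'" for y'
      proof (cases "y' \<in> F")
        case False
        have "E y' (Suc j)" using True agree_sym[OF that] by (auto simp: E_def)
        then have "j < L y'" using EL_max[OF False, of "Suc j"] by simp
        then have "r y' j = y' j" using p(2)[OF False] by (simp add: agree_def)
        then show ?thesis using that True by (simp add: agree_def r_def)
      qed (use that True in \<open>simp add: agree_def r_def\<close>)
      then show ?thesis by blast
    next
      case False
      obtain n where n: "\<forall>l. E y l \<longrightarrow> l < n" using bdd[OF False] by blast
      have "r y' = r y" if a: "agree n y y'" for y'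
      proof -
        have E: "E y' l \<longleftrightarrow> E y l" for l
        proof (cases "l \<le> n")
          case True
          then have "agree l y y'" using a agree_mono by blast
          then show ?thesis unfolding E_def by (meson agree_sym agree_trans)
        next
          case False
          have "agree n y' x \<longrightarrow> agree n y x" for x using a agree_trans by blast
          then have "\<not> E y' n" using n unfolding E_def by blast
          then show ?thesis using n False Emono by (meson linear not_less)
        qed
        then have "E y' = E y" by blast
        then have L: "L y' = L y" by (simp add: L_def)
        have "y' \<notin> F"
        proof
          assume "y' \<in> F"
          then have "E y n" using a by (auto simp: E_def)
          then show False using n by blast
        qed
        moreover have "map y' [0..<L y] = map y [0..<L y]"
          using a n EL[OF False] agree_mono agree_sym unfolding map_upt_eq_iff_agree by (meson less_imp_le)
        ultimately show ?thesis using False L by (simp add: r_def del: map_eq_conv)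
      qed
      then show ?thesis by metis
    qed
  qed
  then show ?thesis using that[of r] p by (metis r_def)
qed

text \<open>The closed set \<open>F\<close> consists of points interleaved with witnesses for their
  membership in each \<open>U n\<close>. Retracting onto \<open>F\<close> and forgetting the
  witnesses gives \<open>\<rho>\<close>; \<open>k\<close> adds the least witnesses.\<close>

lemma gdel_section_retraction:
  assumes "gdel G" "G \<noteq> {}"
  obtains \<rho> k :: "(nat \<Rightarrow> nat) \<Rightarrow> nat \<Rightarrow> nat" where "continuous_on UNIV \<rho>" "\<And>y. \<rho> y \<in> G"
    "continuous_on G k" "\<And>x. x \<in> G \<Longrightarrow> \<rho> (k x) = x"
proof -
  obtain U where U: "\<And>n::nat. open (U n)" "G = (\<Inter>n. U n)" using assms(1) gdel_iff by blast
  define C where "C n m x \<longleftrightarrow> (\<forall>w. agree m x w \<longrightarrow> w \<in> U n)" for n m x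
  define F where "F = {y. \<forall>n. C n (odds y n) (evens y)}"
  define m where "m n x = (LEAST m. C n m x)" for n x
  define k where "k x i = (if even i then x (i div 2) else m (i div 2) x)" for x i
  have C_cong: "C n l x \<longleftrightarrow> C n l y" if "agree l x y" for n l x y
    using that unfolding C_def by (meson agree_sym agree_trans)
  have m: "C n (m n x) x" if "x \<in> G" for n x
  proof -
    have "x \<in> U n" using U(2) that by simp
    from open_seqE[OF U(1) this] have "\<exists>l. C n l x" unfolding C_def by metis
    then show ?thesis unfolding m_def by (rule LeastI_ex)
  qed
  have kF: "k x \<in> F" if "x \<in> G" for x
    using m[OF that] by (simp add: F_def k_def)
  have evF: "evens y \<in> G" if "y \<in> F" for y
  proof -
    have "evens y \<in> U n" for n
    proof -
      have "C n (odds y n) (evens y)" using that by (simp add: F_def)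
      then show ?thesis using agree_refl unfolding C_def by blast
    qed
    then show ?thesis using U(2) by blast
  qed
  have "F \<noteq> {}" using assms(2) kF by blast
  have "closed F"
    unfolding closed_seq_iff
  proof (intro allI impI)
    fix y assume "y \<notin> F"
    then obtain n where n: "\<not> C n (odds y n) (evens y)" by (auto simp: F_def)
    have "z \<notin> F" if "agree (2 * n + 2 + 2 * odds y n) y z" for z
    proof -
      have "odds z n = odds y n" "agree (odds y n) (evens y) (evens z)"
        using that by (auto simp: agree_def)
      then have "\<not> C n (odds z n) (evens z)" using n C_cong by simp
      then show ?thesis by (auto simp: F_def)
    qed
    then show "\<exists>n. \<forall>z. agree n y z \<longrightarrow> z \<notin> F" by blast
  qed
  then obtain r where r: "continuous_on UNIV r" "\<And>y. r y \<in> F" "\<And>y. y \<in> F \<Longrightarrow> r y = y"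
    using closed_retract_seq[OF _ \<open>F \<noteq> {}\<close>] by metis
  have 1: "continuous_on UNIV (evens \<circ> r)"
    by (rule continuous_on_compose[OF r(1) continuous_on_subset[OF continuous_reindex]]) simp
  have 2: "(evens \<circ> r) y \<in> G" for y using evF r(2) by simp
  have 3: "continuous_on G k"
    unfolding continuous_on_seq_iff
  proof (intro ballI allI)
    fix x j assume x: "x \<in> G"
    have "k y j = k x j" if y: "y \<in> G" "agree (max (Suc j) (m (j div 2) x)) x y" for y
    proof (cases "even j")
      case True
      then show ?thesis using y(2) by (auto simp: k_def agree_def)
    next
      case False
      let ?n = "j div 2"
      have "C ?n l x \<longleftrightarrow> C ?n l y" if "l \<le> m ?n x" for l
        using C_cong agree_mono[OF y(2)] that by simp
      then have iff: "l \<le> m ?n x \<Longrightarrow> C ?n l y \<longleftrightarrow> C ?n l x" for l by blast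
      \<comment> \<open>A least witness is read off an initial segment of its own length, which
        makes \<open>k\<close> continuous at odd positions.\<close>
      have "m ?n y = m ?n x"
        unfolding m_def[of ?n y]
      proof (rule Least_equality)
        show "C ?n (m ?n x) y" using iff m[OF x] by simp
        show "m ?n x \<le> l" if "C ?n l y" for l
        proof (rule ccontr)
          assume l: "\<not> m ?n x \<le> l"
          then have "C ?n l x" using iff[of l] that by simp
          then show False using l unfolding m_def by (simp add: Least_le)
        qed
      qed
      then show ?thesis using False by (simp add: k_def)
    qed
    then show "\<exists>n. \<forall>y\<in>G. agree n x y \<longrightarrow> k y j = k x j" by blast
  qed
  have 4: "(evens \<circ> r) (k x) = x" if "x \<in> G" for x
    using r(3)[OF kF[OF that]] by (simp add: k_def)
  show ?thesis by (rule that[of "evens \<circ> r" k, OF 1 2 3 4])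
qed

section \<open>Sets generated by preimages under continuous maps on G-delta sets\<close>

inductive_set piecewise :: "(nat \<Rightarrow> nat) set \<Rightarrow> (nat \<Rightarrow> nat) set set" for Y where
  base: "gdel G \<Longrightarrow> continuous_on G k \<Longrightarrow> {z \<in> G. k z \<in> Y} \<in> piecewise Y"
| compl: "A \<in> piecewise Y \<Longrightarrow> - A \<in> piecewise Y"
| int: "A \<in> piecewise Y \<Longrightarrow> gdel G \<Longrightarrow> A \<inter> G \<in> piecewise Y"

lemma gdel_UNIV: "gdel UNIV"
  by (simp add: open_imp_gdel)

lemma piecewise_refl: "Y \<in> piecewise Y"
  using piecewise.base[OF gdel_UNIV continuous_on_id, of Y] by simp

lemma piecewise_empty: "{} \<in> piecewise Y"
  using piecewise.base[of "{}" "\<lambda>x. x" Y] by simp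

lemma piecewise_vimage:
  assumes "A \<in> piecewise Y" "continuous_on UNIV f"
  shows "f -` A \<in> piecewise Y"
  using assms(1)
proof induction
  case (base G k)
  have "continuous_on (f -` G) (k \<circ> f)"
    using assms(2) base(2) by (intro continuous_on_compose) (auto intro: continuous_on_subset)
  moreover have "f -` {z \<in> G. k z \<in> Y} = {z \<in> f -` G. (k \<circ> f) z \<in> Y}" by auto
  ultimately show ?case using piecewise.base[OF gdel_vimage[OF assms(2) base(1)]] by simp
next
  case (compl A)
  then show ?case by (simp add: vimage_Compl piecewise.compl)
next
  case (int A G)
  then show ?case by (simp add: gdel_vimage[OF assms(2)] piecewise.int)
qed

lemma piecewise_wadge_le: "A \<le>\<^sub>W B \<Longrightarrow> B \<in> piecewise Y \<Longrightarrow> A \<in> piecewise Y"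
  unfolding wadge_le_def using piecewise_vimage by blast

text \<open>The closure rules do not mention the parameter, so changing it requires a check of the
  base case only.\<close>

lemma piecewise_subset:
  assumes "\<And>G k. gdel G \<Longrightarrow> continuous_on G k \<Longrightarrow> {z \<in> G. k z \<in> Y} \<in> piecewise Z"
    and "A \<in> piecewise Y"
  shows "A \<in> piecewise Z"
  using assms(2) by induction (auto intro: assms(1) piecewise.intros)

lemma piecewise_Compl:
  assumes "A \<in> piecewise Y" shows "A \<in> piecewise (- Y)"
  using _ assms
proof (rule piecewise_subset)
  fix G and k :: "(nat \<Rightarrow> nat) \<Rightarrow> nat \<Rightarrow> nat" assume "gdel G" "continuous_on G k"
  then have "- {z \<in> G. k z \<in> - Y} \<inter> G \<in> piecewise (- Y)" by (intro piecewise.intros)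
  moreover have "- {z \<in> G. k z \<in> - Y} \<inter> G = {z \<in> G. k z \<in> Y}" by auto
  ultimately show "{z \<in> G. k z \<in> Y} \<in> piecewise (- Y)" by simp
qed

text \<open>\<open>\<kappa>\<close> splits the space into clopen pieces, one for each initial
  segment of length \<open>\<kappa> z\<close>. Pulled back along \<open>k\<close>, they give sets on
  which the values of \<open>k\<close> share a segment, so that one section can replace
  \<open>Y\<close>; complements and intersections keep the partition.\<close>

lemma piecewise_partition:
  fixes \<kappa> :: "(nat \<Rightarrow> nat) \<Rightarrow> nat"
  assumes \<kappa>: "\<And>z z'. agree (\<kappa> z) z z' \<Longrightarrow> \<kappa> z' = \<kappa> z"
    and "A \<in> piecewise Y"
  shows "\<exists>V :: nat \<Rightarrow> (nat \<Rightarrow> nat) set. (\<forall>n. fsig (V n) \<and> gdel (V n)) \<and> disjoint_family V \<and> (\<Union>n. V n) = UNIV \<and>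
    (\<forall>n. \<exists>z. A \<inter> V n \<in> piecewise (section_at Y z (\<kappa> z)))"
  using assms(2)
proof induction
  case (base G k)
  define D where "D n = {z. map z [0..<\<kappa> z] = from_nat n}" for n
  have D: "open (D n)" for n
    unfolding open_seq_iff
  proof (intro ballI exI allI impI)
    fix x y assume "x \<in> D n" "agree (\<kappa> x) x y"
    then show "y \<in> D n"
      using \<kappa>[of x y] map_upt_eq_iff_agree[of x "\<kappa> x" y] by (simp add: D_def del: map_eq_conv)
  qed
  have "\<forall>n. \<exists>W. open W \<and> W \<inter> G = k -` D n \<inter> G"
    using base(2) D unfolding continuous_on_open_invariant by blast
  then obtain W where W: "\<And>n. open (W n)" "\<And>n. W n \<inter> G = k -` D n \<inter> G" by metis
  \<comment> \<open>The sets \<open>W n\<close> may overlap, hence the disjointification. Piece 0,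
    their common complement, misses \<open>G\<close>.\<close>
  define V where "V = case_nat (- (\<Union>n. W n)) (disjointed W)"
  have clo: "closed (- (\<Union>n. W n))" by (intro closed_Compl open_UN ballI W(1))
  have dis: "fsig (disjointed W n) \<and> gdel (disjointed W n)" for n
  proof -
    have "open (\<Union>i\<in>{0..<n}. W i)" using W(1) by blast
    then show ?thesis
      using fsigma_in_diff[of euclidean "W n" "\<Union>i\<in>{0..<n}. W i"]
        gdelta_in_diff[of euclidean "W n" "\<Union>i\<in>{0..<n}. W i"] W(1)
      by (simp add: disjointed_def open_imp_fsig open_imp_gdel)
  qed
  have "\<forall>n. fsig (V n) \<and> gdel (V n)"
    using clo dis by (auto simp: V_def closed_imp_fsig closed_imp_gdel split: nat.split)
  moreover have "disjoint_family V"
  proof -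
    have "disjointed W m \<inter> disjointed W n = {}" if "m \<noteq> n" for m n
      using disjoint_family_disjointed[of W] that by (simp add: disjoint_family_on_def)
    moreover have "- (\<Union>n. W n) \<inter> disjointed W n = {}" for n
      by (auto simp: disjointed_def)
    ultimately show ?thesis
      by (auto simp: disjoint_family_on_def V_def split: nat.split)
  qed
  moreover have "(\<Union>n. V n) = UNIV"
  proof -
    have "x \<in> (\<Union>n. V n)" for x
    proof (cases "x \<in> (\<Union>n. W n)")
      case True
      then have "x \<in> (\<Union>n. disjointed W n)" by (simp only: UN_disjointed_eq)
      then obtain n where "x \<in> V (Suc n)" by (auto simp: V_def)
      then show ?thesis by blast
    next
      case False
      then have "x \<in> V 0" by (simp add: V_def)
      then show ?thesis by blast
    qed
    then show ?thesis by blast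
  qed
  moreover have "\<exists>z. {z \<in> G. k z \<in> Y} \<inter> V n \<in> piecewise (section_at Y z (\<kappa> z))" for n
  proof (cases "G \<inter> V n = {}")
    case True
    then have "{z \<in> G. k z \<in> Y} \<inter> V n = {}" by blast
    then have "{z \<in> G. k z \<in> Y} \<inter> V n \<in> piecewise (section_at Y undefined (\<kappa> undefined))"
      by (simp only: piecewise_empty)
    then show ?thesis by (intro exI[of _ undefined])
  next
    case False
    then obtain y where y: "y \<in> G" "y \<in> V n" by blast
    have W_D: "x \<in> W i \<longleftrightarrow> k x \<in> D i" if "x \<in> G" for x i
    proof -
      have "x \<in> W i \<inter> G \<longleftrightarrow> x \<in> k -` D i \<inter> G" unfolding W(2) ..
      then show ?thesis using that by simp
    qed
    have "k y \<in> D (to_nat (map (k y) [0..<\<kappa> (k y)]))" by (simp add: D_def)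
    then have "y \<notin> V 0" using W_D[OF y(1)] by (auto simp: V_def)
    then obtain i where i: "n = Suc i" using y(2) by (cases n) auto
    let ?z = "k y" and ?k = "\<kappa> (k y)"
    \<comment> \<open>On the piece, values of \<open>k\<close> share their first \<open>?k\<close>
      entries with \<open>?z\<close>; dropping these and prepending those of \<open>?z\<close>
      changes nothing.\<close>
    have pre: "(\<lambda>j. if j < ?k then ?z j else k x (j - ?k + ?k)) = k x" if x: "x \<in> G \<inter> V n" for x
    proof -
      have "x \<in> W i" "y \<in> W i" using x y(2) by (auto simp: i V_def disjointed_def)
      then have "k x \<in> D i" "k y \<in> D i" using x y(1) W_D by auto
      then have eq: "map (k x) [0..<\<kappa> (k x)] = map (k y) [0..<?k]"
        unfolding D_def mem_Collect_eq by (rule trans[OF _ sym])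
      from arg_cong[OF eq, of length] have "\<kappa> (k x) = ?k" by simp
      with eq have "agree ?k (k x) (k y)" by (simp only: map_upt_eq_iff_agree)
      then show ?thesis by (auto simp: agree_def)
    qed
    have "continuous_on (G \<inter> V n) ((\<lambda>w j. w (j + ?k)) \<circ> k)"
      by (rule continuous_on_compose[OF continuous_on_subset[OF base(2)]
            continuous_on_subset[OF continuous_reindex]]) auto
    moreover have "gdel (G \<inter> V n)"
      using base(1) \<open>\<forall>n. fsig (V n) \<and> gdel (V n)\<close> gdelta_in_Int by blast
    ultimately have "{x \<in> G \<inter> V n. ((\<lambda>w j. w (j + ?k)) \<circ> k) x \<in> section_at Y ?z ?k} \<in> piecewise (section_at Y ?z ?k)"
      by (intro piecewise.base)
    also have "{x \<in> G \<inter> V n. ((\<lambda>w j. w (j + ?k)) \<circ> k) x \<in> section_at Y ?z ?k} = {x \<in> G. k x \<in> Y} \<inter> V n"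
      unfolding section_at_def o_def mem_Collect_eq by (auto simp: pre[simplified])
    finally show ?thesis by blast
  qed
  ultimately show ?case by blast
next
  case (compl A)
  then obtain V :: "nat \<Rightarrow> (nat \<Rightarrow> nat) set" where V: "\<forall>n. fsig (V n) \<and> gdel (V n)" "disjoint_family V" "(\<Union>n. V n) = UNIV"
    "\<forall>n. \<exists>z. A \<inter> V n \<in> piecewise (section_at Y z (\<kappa> z))" by blast
  have "\<exists>z. - A \<inter> V n \<in> piecewise (section_at Y z (\<kappa> z))" for n
  proof -
    have "- A \<inter> V n = - (A \<inter> V n) \<inter> V n" by blast
    then show ?thesis using V(1,4) piecewise.intros(2,3) by metis
  qed
  then show ?case using V(1-3) by blast
next
  case (int A G)
  then obtain V :: "nat \<Rightarrow> (nat \<Rightarrow> nat) set" where V: "\<forall>n. fsig (V n) \<and> gdel (V n)" "disjoint_family V" "(\<Union>n. V n) = UNIV"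
    "\<forall>n. \<exists>z. A \<inter> V n \<in> piecewise (section_at Y z (\<kappa> z))" by blast
  have "\<exists>z. (A \<inter> G) \<inter> V n \<in> piecewise (section_at Y z (\<kappa> z))" for n
  proof -
    have "(A \<inter> G) \<inter> V n = (A \<inter> V n) \<inter> G" by blast
    then show ?thesis using V(4) int(2) piecewise.int by metis
  qed
  then show ?case using V(1-3) by blast
qed

section \<open>Minimal nonselfdual sets absorb intersections with G-delta sets\<close>

section \<open>Closure under unions with F-sigma sets\<close>

lemma continuous_on_UNIV_comp:
  "continuous_on UNIV f \<Longrightarrow> continuous_on UNIV g \<Longrightarrow> continuous_on UNIV (f \<circ> g)"
  by (rule continuous_on_compose[OF _ continuous_on_subset]) auto

context det_sets
begin

lemma Int_gdel: "A \<in> S \<Longrightarrow> gdel G \<Longrightarrow> A \<inter> G \<in> S"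
  by (rule Int[OF _ borel[OF gdel_borel]])

text \<open>Extended by a constant off \<open>G\<close>, \<open>k\<close> is a Borel function on the
  whole space.\<close>

lemma preimage_on_gdel:
  assumes "gdel G" "continuous_on G k" "Y \<in> S"
  shows "{z \<in> G. k z \<in> Y} \<in> S"
proof -
  have "(\<lambda>z. if z \<in> G then k z else (\<lambda>_. 0)) \<in> borel_measurable borel"
    by (intro borel_measurable_continuous_on_if gdel_borel assms continuous_on_const)
  then have "G \<inter> (\<lambda>z. if z \<in> G then k z else (\<lambda>_. 0)) -` Y \<in> S"
    by (intro Int borel gdel_borel assms(1) borel_vimage assms(3))
  moreover have "G \<inter> (\<lambda>z. if z \<in> G then k z else (\<lambda>_. 0)) -` Y = {z \<in> G. k z \<in> Y}" by auto
  ultimately show ?thesis by simp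
qed

text \<open>
  In the game where the second player has to answer a point \<open>z\<close> of \<open>G\<close> with a point of \<open>Y\<close> iff
  \<open>k z \<in> Y\<close>, a winning strategy of the first player would make \<open>Y\<close> selfdual.
\<close>

lemma extend_reduction:
  assumes "gdel G" "continuous_on G k" "Y \<in> S" "\<not> Y \<le>\<^sub>W - Y"
  obtains f where "continuous_on UNIV f" "{z \<in> G. k z \<in> Y} = f -` Y \<inter> G"
proof -
  let ?B = "{z \<in> G. k z \<in> Y}"
  let ?R = "{(z, y). z \<in> G \<longrightarrow> (k z \<in> Y \<longleftrightarrow> y \<in> Y)}"
  have B: "?B \<in> S" using preimage_on_gdel assms(1-3) .
  have G: "G \<in> S" using assms(1) by (intro borel gdel_borel)
  have "{w. (evens w, odds w) \<notin> ?R} =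
      (evens -` ?B \<inter> - (odds -` Y)) \<union> (evens -` (G \<inter> - ?B) \<inter> odds -` Y)" by auto
  also have "\<dots> \<in> S"
    by (intro Un Int Compl vimage continuous_reindex B G assms(3))
  finally show ?thesis
  proof (cases rule: game_dichotomy)
    case (1 f)
    then have "?B = f -` Y \<inter> G" by auto
    with 1(1) show ?thesis by (rule that)
  next
    case (2 g)
    then have g: "g y \<in> G" "k (g y) \<in> Y \<longleftrightarrow> y \<notin> Y" for y by auto
    have "continuous_on UNIV (k \<circ> g)"
      by (rule continuous_on_compose[OF contraction_continuous[OF 2(1)] continuous_on_subset[OF assms(2)]])
        (use g(1) in auto)
    from wadge_le_vimage[OF this, of Y] have "(k \<circ> g) -` Y \<le>\<^sub>W Y" .
    moreover have "(k \<circ> g) -` Y = - Y" by (rule set_eqI) (simp add: g(2))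
    ultimately have "- Y \<le>\<^sub>W Y" by simp
    then show ?thesis using assms(4) by (simp add: wadge_le_Compl_swap)
  qed
qed

end

text \<open>The situation after a minimal \<open>Y\<close> has been chosen and shown not to be
  selfdual. It is symmetric in \<open>Y\<close> and \<open>- Y\<close>, and \<open>X_not\<close>
  keeps \<open>Y\<close> from being empty or the whole space.\<close>

locale wadge_base = det_sets +
  fixes X Y :: "(nat \<Rightarrow> nat) set"
  assumes Y: "Y \<in> S" and nonselfdual: "\<not> Y \<le>\<^sub>W - Y"
    and X_piecewise: "X \<in> piecewise Y" and X_not: "X \<notin> piecewise {}"
    and minimal: "\<And>Z. Z \<in> S \<Longrightarrow> X \<in> piecewise Z \<Longrightarrow> Y \<le>\<^sub>W Z \<or> Y \<le>\<^sub>W - Z"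
begin

text \<open>
  If \<open>A \<inter> G\<close> is not reducible to \<open>Y\<close>, then \<open>- Y\<close> is itself of the form \<open>h -` Y \<inter> H\<close>, so that
  \<open>Y\<close> is selfdual relative to \<open>H\<close>; transporting \<open>Y\<close> from \<open>H\<close> to the whole space
  yields a strictly smaller set from which \<open>X\<close> is still piecewise obtained.
\<close>

lemma wadge_le_Int_gdel:
  assumes A: "A \<le>\<^sub>W Y" and G: "gdel G"
  shows "A \<inter> G \<le>\<^sub>W Y"
proof (rule ccontr)
  assume n: "\<not> A \<inter> G \<le>\<^sub>W Y"
  obtain f where f: "continuous_on UNIV f" "A = f -` Y" using A wadge_le_def by blast
  have "A \<in> S" using f vimage Y by simp
  then have "A \<inter> G \<in> S" using G by (rule Int_gdel)
  from wadge[OF this Y n] obtain g where g: "contraction g" "g -` (A \<inter> G) = - Y" .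
  have cg: "continuous_on UNIV g" using g(1) by (rule contraction_continuous)
  define H where "H = g -` G"
  have H: "gdel H" unfolding H_def using cg G by (rule gdel_vimage)
  define h where "h = f \<circ> g"
  have h: "continuous_on UNIV h"
    unfolding h_def using f(1) cg by (rule continuous_on_UNIV_comp)
  \<comment> \<open>\<open>g\<close> maps into \<open>A \<inter> G\<close> exactly off
    \<open>Y\<close>, so points outside \<open>H\<close> belong to \<open>Y\<close>.\<close>
  have YH: "- Y = h -` Y \<inter> H" using g(2) f(2) by (auto simp: h_def H_def)
  show False
  proof (cases "H = {}")
    case True
    then have "Y = UNIV" using YH by blast
    \<comment> \<open>With \<open>Y\<close> the whole space, the base sets are just G-delta
      sets.\<close>
    have "A \<in> piecewise {}" if "A \<in> piecewise Y" for A
    proof (rule piecewise_subset[OF _ that])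
      fix G and k :: "(nat \<Rightarrow> nat) \<Rightarrow> nat \<Rightarrow> nat" assume "gdel G"
      then have "- {} \<inter> G \<in> piecewise {}" by (intro piecewise.int piecewise.compl piecewise_empty)
      then show "{z \<in> G. k z \<in> Y} \<in> piecewise {}" using \<open>Y = UNIV\<close> by simp
    qed
    then show False using X_piecewise X_not by blast
  next
    case False
    show False
    proof (rule gdel_section_retraction[OF H False])
      fix \<rho> k :: "(nat \<Rightarrow> nat) \<Rightarrow> nat \<Rightarrow> nat"
      assume \<rho>: "continuous_on UNIV \<rho>" "\<And>y. \<rho> y \<in> H" "continuous_on H k"
        "\<And>x. x \<in> H \<Longrightarrow> \<rho> (k x) = x"
      \<comment> \<open>\<open>Z\<close> is \<open>Y\<close> seen on \<open>H\<close>, where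
        \<open>h\<close> reduces the complement of \<open>Y\<close> to \<open>Y\<close>; hence both
        \<open>Z\<close> and \<open>- Z\<close> reduce to \<open>Y\<close>.\<close>
      define Z where "Z = \<rho> -` Y"
      have ZS: "Z \<in> S" unfolding Z_def using \<rho>(1) Y by (rule vimage)
      have ZY: "Z \<le>\<^sub>W Y" unfolding Z_def using \<rho>(1) by (rule wadge_le_vimage)
      have hZ: "- Z = (h \<circ> \<rho>) -` Y"
      proof (rule set_eqI)
        fix y
        have "\<rho> y \<in> - Y \<longleftrightarrow> \<rho> y \<in> h -` Y \<inter> H" by (simp only: YH)
        then show "y \<in> - Z \<longleftrightarrow> y \<in> (h \<circ> \<rho>) -` Y" using \<rho>(2)[of y] by (simp add: Z_def)
      qed
      have CZY: "- Z \<le>\<^sub>W Y"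
        unfolding hZ by (rule wadge_le_vimage[OF continuous_on_UNIV_comp[OF h \<rho>(1)]])
      have "X \<in> piecewise Z"
      proof (rule piecewise_subset[OF _ X_piecewise])
        fix G0 and k0 :: "(nat \<Rightarrow> nat) \<Rightarrow> nat \<Rightarrow> nat" assume G0: "gdel G0" "continuous_on G0 k0"
        let ?G1 = "{z \<in> G0. k0 z \<in> H}"
        have G1: "gdel ?G1" using gdel_vimage_on[OF G0(2,1) H] .
        have "continuous_on ?G1 (k \<circ> k0)"
          by (rule continuous_on_compose[OF continuous_on_subset[OF G0(2)] continuous_on_subset[OF \<rho>(3)]]) auto
        \<comment> \<open>Where \<open>k0\<close> leaves \<open>H\<close> its values lie in
          \<open>Y\<close>; elsewhere membership is tested in \<open>Z\<close> through
          \<open>k\<close>. The Boolean expression joins the two cases.\<close>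
        then have "- (- {z \<in> ?G1. (k \<circ> k0) z \<in> Z} \<inter> ?G1) \<inter> G0 \<in> piecewise Z"
          using G0(1) G1 by (intro piecewise.intros)
        moreover have "- (- {z \<in> ?G1. (k \<circ> k0) z \<in> Z} \<inter> ?G1) \<inter> G0 = {z \<in> G0. k0 z \<in> Y}"
        proof -
          have "k (k0 z) \<in> Z \<longleftrightarrow> k0 z \<in> Y" if "k0 z \<in> H" for z using \<rho>(4)[OF that] by (simp add: Z_def)
          moreover have "k0 z \<in> Y" if "k0 z \<notin> H" for z
          proof (rule ccontr)
            assume "k0 z \<notin> Y"
            then have "k0 z \<in> h -` Y \<inter> H" by (simp only: YH[symmetric] Compl_iff not_False_eq_True)
            then show False using that by simp
          qed
          ultimately show ?thesis by (intro set_eqI) auto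
        qed
        ultimately show "{z \<in> G0. k0 z \<in> Y} \<in> piecewise Z" by simp
      qed
      then have "Y \<le>\<^sub>W Z \<or> Y \<le>\<^sub>W - Z" using minimal ZS by blast
      moreover have "Z \<le>\<^sub>W - Y" using CZY by (simp add: wadge_le_Compl_swap)
      moreover have "- Z \<le>\<^sub>W - Y" using ZY by (simp add: wadge_le_Compl)
      ultimately show False using nonselfdual wadge_le_trans by blast
    qed
  qed
qed

lemma Compl_wadge_base: "wadge_base S X (- Y)"
proof (unfold_locales)
  show "- Y \<in> S" using Y by (rule Compl)
  show "\<not> - Y \<le>\<^sub>W - (- Y)" using nonselfdual by (simp add: wadge_le_Compl_swap)
  show "X \<in> piecewise (- Y)" using X_piecewise by (rule piecewise_Compl)
  show "X \<notin> piecewise {}" by (rule X_not)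
  fix Z assume "Z \<in> S" "X \<in> piecewise Z"
  then show "- Y \<le>\<^sub>W Z \<or> - Y \<le>\<^sub>W - Z"
    using minimal[of Z] wadge_le_Compl[of Y Z] wadge_le_Compl_swap[of Y Z] by blast
qed

text \<open>As \<open>Y\<close> is not selfdual, partial preimages extend to total ones up to an
  intersection with a G-delta set, which both \<open>Y\<close> and \<open>- Y\<close>
  absorb.\<close>

lemma piecewise_wadge_le_base:
  assumes "A \<in> piecewise Y"
  shows "A \<le>\<^sub>W Y \<or> A \<le>\<^sub>W - Y"
  using assms
proof induction
  case (base G k)
  obtain f where f: "continuous_on UNIV f" "{z \<in> G. k z \<in> Y} = f -` Y \<inter> G"
    using extend_reduction[OF base Y nonselfdual] by metis
  have "f -` Y \<inter> G \<le>\<^sub>W Y" by (rule wadge_le_Int_gdel[OF wadge_le_vimage[OF f(1)] base(1)])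
  then show ?case by (simp add: f(2))
next
  case (compl A)
  then show ?case using wadge_le_Compl[of A Y] wadge_le_Compl_swap[of A Y] by blast
next
  case (int A G)
  then show ?case
    using wadge_le_Int_gdel[of A G] wadge_base.wadge_le_Int_gdel[OF Compl_wadge_base, of A G] by blast
qed

text \<open>\<open>X\<close> is Wadge equivalent to \<open>Y\<close> or to \<open>- Y\<close>:
  minimality gives the reverse reduction up to a complement, and nonselfduality of \<open>X\<close>
  picks the matching side.\<close>

lemma closed_Int_gdel:
  assumes X: "X \<in> S" "\<not> X \<le>\<^sub>W - X" and G: "gdel G"
  shows "A \<le>\<^sub>W X \<Longrightarrow> A \<inter> G \<le>\<^sub>W X" "A \<le>\<^sub>W - X \<Longrightarrow> A \<inter> G \<le>\<^sub>W - X"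
proof -
  have *: "B \<inter> G \<le>\<^sub>W C" if "B \<le>\<^sub>W C" "C \<le>\<^sub>W D" "D \<le>\<^sub>W C" "D = Y \<or> D = - Y" for B C D
  proof -
    have "B \<le>\<^sub>W D" using that(1,2) by (rule wadge_le_trans)
    then have "B \<inter> G \<le>\<^sub>W D"
      using that(4) wadge_le_Int_gdel[OF _ G] wadge_base.wadge_le_Int_gdel[OF Compl_wadge_base _ G] by blast
    then show ?thesis using that(3) by (rule wadge_le_trans)
  qed
  have XY: "X \<le>\<^sub>W Y \<or> X \<le>\<^sub>W - Y" using X_piecewise by (rule piecewise_wadge_le_base)
  have YX: "Y \<le>\<^sub>W X \<or> Y \<le>\<^sub>W - X" using X(1) piecewise_refl by (rule minimal)
  obtain D where D: "X \<le>\<^sub>W D" "D \<le>\<^sub>W X" "D = Y \<or> D = - Y"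
  proof (cases "X \<le>\<^sub>W Y")
    case True
    then have "\<not> Y \<le>\<^sub>W - X" using X(2) wadge_le_trans[OF True, of "- X"] by blast
    then show ?thesis using True YX that by blast
  next
    case False
    then have "X \<le>\<^sub>W - Y" using XY by blast
    moreover have "\<not> - Y \<le>\<^sub>W - X" using X(2) wadge_le_trans[OF calculation, of "- X"] by blast
    ultimately show ?thesis
      using YX wadge_le_Compl[of Y X] wadge_le_Compl_swap[of Y X] that[of "- Y"] by blast
  qed
  show "A \<le>\<^sub>W X \<Longrightarrow> A \<inter> G \<le>\<^sub>W X" using *[of A X D] D by blast
  have "- X \<le>\<^sub>W - D" "- D \<le>\<^sub>W - X" "- D = Y \<or> - D = - Y"
    using D wadge_le_Compl by auto
  then show "A \<le>\<^sub>W - X \<Longrightarrow> A \<inter> G \<le>\<^sub>W - X" using *[of A "- X" "- D"] by blast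
qed

end

context det_sets
begin

text \<open>Otherwise every point has an initial segment at which the section of \<open>Y\<close> no
  longer yields \<open>X\<close>. Along the induced partition \<open>X\<close> reduces to none of
  its pieces, so by Wadge's lemma the complements of the pieces reduce to \<open>X\<close>; gluing
  them reduces \<open>- X\<close> to \<open>X\<close>.\<close>

lemma minimal_nonselfdual:
  assumes X: "X \<in> S" "\<not> X \<le>\<^sub>W - X" and Y: "Y \<in> S" "X \<in> piecewise Y"
    and minimal: "\<And>Z. Z \<in> S \<Longrightarrow> X \<in> piecewise Z \<Longrightarrow> Y \<le>\<^sub>W Z \<or> Y \<le>\<^sub>W - Z"
    and level: "\<And>(A :: nat \<Rightarrow> _) V. (\<And>n. A n \<le>\<^sub>W X) \<Longrightarrow> (\<And>n. fsig (V n) \<and> gdel (V n)) \<Longrightarrow>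
      disjoint_family V \<Longrightarrow> (\<Union>n. V n) = UNIV \<Longrightarrow> (\<Union>n. A n \<inter> V n) \<le>\<^sub>W X"
  shows "\<not> Y \<le>\<^sub>W - Y"
proof
  assume sd: "Y \<le>\<^sub>W - Y"
  define P where "P z k \<longleftrightarrow> X \<notin> piecewise (section_at Y z k)" for z k
  \<comment> \<open>Being least, this length is determined by the segment itself, as
    \<open>piecewise_partition\<close> requires.\<close>
  define \<kappa> where "\<kappa> z = (LEAST k. P z k)" for z
  have ex: "\<exists>k. P z k" for z
    using selfdual_section[OF Y(1) sd, of z] minimal[OF section_at_in[OF Y(1)], of z]
    unfolding P_def by blast
  then have P: "P z (\<kappa> z)" for z unfolding \<kappa>_def by (rule LeastI_ex)
  have "\<kappa> z' = \<kappa> z" if "agree (\<kappa> z) z z'" for z z'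
  proof -
    have eq: "P z' k \<longleftrightarrow> P z k" if "k \<le> \<kappa> z" for k
    proof -
      have "(\<lambda>i. if i < k then z' i else y (i - k)) = (\<lambda>i. if i < k then z i else y (i - k))" for y
        using \<open>agree (\<kappa> z) z z'\<close> that by (auto simp: agree_def)
      then show ?thesis by (simp add: P_def section_at_def)
    qed
    show ?thesis
      unfolding \<kappa>_def[of z']
    proof (rule Least_equality)
      show "P z' (\<kappa> z)" using eq P by simp
      show "\<kappa> z \<le> k" if "P z' k" for k
      proof (rule ccontr)
        assume l: "\<not> \<kappa> z \<le> k"
        then have "P z k" using eq[of k] that by simp
        then show False using l unfolding \<kappa>_def by (simp add: Least_le)
      qed
    qed
  qed
  from piecewise_partition[of \<kappa>, OF this Y(2)]
  obtain V :: "nat \<Rightarrow> (nat \<Rightarrow> nat) set" where V: "\<And>n. fsig (V n) \<and> gdel (V n)" "disjoint_family V" "(\<Union>n. V n) = UNIV"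
    "\<And>n. \<exists>z. X \<inter> V n \<in> piecewise (section_at Y z (\<kappa> z))" by metis
  have "- (X \<inter> V n) \<le>\<^sub>W X" for n
  proof -
    obtain z where z: "X \<inter> V n \<in> piecewise (section_at Y z (\<kappa> z))" using V(4) by blast
    have "\<not> X \<le>\<^sub>W X \<inter> V n" using piecewise_wadge_le[OF _ z] P[of z] unfolding P_def by blast
    moreover have "X \<inter> V n \<in> S" using X(1) V(1) by (simp add: Int_gdel)
    ultimately show ?thesis using wadge_le_cases[OF X(1)] by blast
  qed
  from level[OF this V(1-3)] have "(\<Union>n. - (X \<inter> V n) \<inter> V n) \<le>\<^sub>W X" .
  moreover have "(\<Union>n. - (X \<inter> V n) \<inter> V n) = - X" using V(3) by blast
  ultimately show False using X(2) by (simp add: wadge_le_Compl_swap)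
qed

theorem nonselfdual_closure:
  assumes X: "X \<in> S" "\<not> X \<le>\<^sub>W - X" "X \<notin> piecewise {}"
    and level: "\<And>(A :: nat \<Rightarrow> _) V. (\<And>n. A n \<le>\<^sub>W X) \<Longrightarrow> (\<And>n. fsig (V n) \<and> gdel (V n)) \<Longrightarrow>
      disjoint_family V \<Longrightarrow> (\<Union>n. V n) = UNIV \<Longrightarrow> (\<Union>n. A n \<inter> V n) \<le>\<^sub>W X"
    and A: "A \<le>\<^sub>W X"
  shows "gdel G \<Longrightarrow> A \<inter> G \<le>\<^sub>W X" "fsig U \<Longrightarrow> A \<union> U \<le>\<^sub>W X"
proof -
  obtain Y where Y: "Y \<in> S" "X \<in> piecewise Y"
    "\<And>Z. Z \<in> S \<Longrightarrow> X \<in> piecewise Z \<Longrightarrow> Y \<le>\<^sub>W Z \<or> Y \<le>\<^sub>W - Z"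
    using wadge_minimal[of X "\<lambda>Y. X \<in> piecewise Y", OF X(1) piecewise_refl] by metis
  have "\<not> Y \<le>\<^sub>W - Y"
    using minimal_nonselfdual[OF X(1,2) Y level] by blast
  then interpret wadge_base S X Y
    by unfold_locales (use X(3) Y in auto)
  show "gdel G \<Longrightarrow> A \<inter> G \<le>\<^sub>W X" using closed_Int_gdel(1)[OF X(1,2) _ A] by blast
  assume "fsig U"
  then have "gdel (- U)" by (simp add: gdel_Compl)
  moreover have "- A \<le>\<^sub>W - X" using A by (simp add: wadge_le_Compl)
  ultimately have "- A \<inter> - U \<le>\<^sub>W - X" using closed_Int_gdel(2)[OF X(1,2)] by blast
  then have "- (- A \<inter> - U) \<le>\<^sub>W X" by (simp only: wadge_le_Compl_swap)
  then show "A \<union> U \<le>\<^sub>W X" by simp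
qed

end

section \<open>Chains of finite sequences, and the ideal of branches\<close>

section \<open>The ideal generated by branches\<close>

definition node :: "nat \<Rightarrow> nat list" where "node = list_decode"

definition branch :: "(nat \<Rightarrow> nat) \<Rightarrow> nat set" where
  "branch x = {m. node m = map x [0..<length (node m)]}"

definition branch_ideal :: "(nat \<Rightarrow> nat) set \<Rightarrow> nat set set" where
  "branch_ideal X = {A. \<exists>E B. finite E \<and> finite B \<and> B \<subseteq> X \<and> A \<subseteq> E \<union> (\<Union>x\<in>B. branch x)}"

definition linear_nodes :: "nat set \<Rightarrow> bool" where
  "linear_nodes A \<longleftrightarrow> (\<forall>m\<in>A. \<forall>n\<in>A. prefix (node m) (node n) \<or> prefix (node n) (node m))"

text \<open>The union of a chain of nodes; the value is unspecified if no node of \<open>A\<close>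
  is longer than \<open>n\<close>.\<close>

definition branch_limit :: "nat set \<Rightarrow> nat \<Rightarrow> nat" where
  "branch_limit A n = node (LEAST m. m \<in> A \<and> n < length (node m)) ! n"

lemma branch_idealI:
  "finite E \<Longrightarrow> finite B \<Longrightarrow> B \<subseteq> X \<Longrightarrow> A \<subseteq> E \<union> (\<Union>x\<in>B. branch x) \<Longrightarrow> A \<in> branch_ideal X"
  unfolding branch_ideal_def by blast

lemma branch_idealE:
  assumes "A \<in> branch_ideal X"
  obtains E B where "finite E" "finite B" "B \<subseteq> X" "A \<subseteq> E \<union> (\<Union>x\<in>B. branch x)"
  using assms unfolding branch_ideal_def by blast

lemma branch_ideal_subset: "A \<in> branch_ideal X \<Longrightarrow> A' \<subseteq> A \<Longrightarrow> A' \<in> branch_ideal X"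
  by (elim branch_idealE, rule branch_idealI) auto

lemma branch_ideal_finite: "finite A \<Longrightarrow> A \<in> branch_ideal X"
  by (rule branch_idealI[of A "{}"]) auto

lemma branch_ideal_Un:
  assumes "A \<in> branch_ideal X" "A' \<in> branch_ideal X" shows "A \<union> A' \<in> branch_ideal X"
proof -
  obtain E B where 1: "finite E" "finite B" "B \<subseteq> X" "A \<subseteq> E \<union> (\<Union>x\<in>B. branch x)"
    using assms(1) by (rule branch_idealE)
  obtain E' B' where 2: "finite E'" "finite B'" "B' \<subseteq> X" "A' \<subseteq> E' \<union> (\<Union>x\<in>B'. branch x)"
    using assms(2) by (rule branch_idealE)
  show ?thesis
    by (rule branch_idealI[of "E \<union> E'" "B \<union> B'"]) (use 1 2 in auto)
qed

lemma branch_ideal_UN: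
  "finite T \<Longrightarrow> (\<And>s. s \<in> T \<Longrightarrow> A s \<in> branch_ideal X) \<Longrightarrow> (\<Union>s\<in>T. A s) \<in> branch_ideal X"
  by (induction T rule: finite_induct) (auto intro: branch_ideal_Un branch_ideal_finite)

lemma node_inject: "node m = node n \<longleftrightarrow> m = n"
  by (simp add: node_def list_decode_eq)

lemma branch_nth: "m \<in> branch x \<Longrightarrow> n < length (node m) \<Longrightarrow> node m ! n = x n"
  unfolding branch_def by (metis (mono_tags, lifting) diff_zero add_0 mem_Collect_eq nth_map_upt)

lemma prefix_upt: "m \<le> n \<Longrightarrow> prefix (map x [0..<m]) (map x [0..<n])"
  using upt_add_eq_append[of 0 m "n - m"] by (simp add: prefix_def)

lemma linear_branch: "linear_nodes (branch x)"
  unfolding linear_nodes_def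
proof (intro ballI)
  fix m n assume "m \<in> branch x" "n \<in> branch x"
  then have mn: "node m = map x [0..<length (node m)]" "node n = map x [0..<length (node n)]"
    by (simp_all add: branch_def)
  show "prefix (node m) (node n) \<or> prefix (node n) (node m)"
    using prefix_upt[of "length (node m)" "length (node n)" x]
      prefix_upt[of "length (node n)" "length (node m)" x] mn by (metis linear)
qed

lemma linear_nodes_subset: "linear_nodes A \<Longrightarrow> A' \<subseteq> A \<Longrightarrow> linear_nodes A'"
  unfolding linear_nodes_def by blast

text \<open>Comparable nodes of equal length coincide, so a chain has at most one node of each
  length.\<close>

lemma linear_unbounded:
  assumes "linear_nodes A" "infinite A"
  shows "\<exists>m\<in>A. n < length (node m)"
proof (rule ccontr)
  assume "\<not> ?thesis"
  then have "(\<lambda>m. length (node m)) ` A \<subseteq> {..n}" by auto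
  then have "finite ((\<lambda>m. length (node m)) ` A)" by (rule finite_subset) simp
  moreover have "inj_on (\<lambda>m. length (node m)) A"
  proof (rule inj_onI)
    fix m m' assume mm: "m \<in> A" "m' \<in> A" "length (node m) = length (node m')"
    then have "prefix (node m) (node m') \<or> prefix (node m') (node m)"
      using assms(1) unfolding linear_nodes_def by blast
    then have "node m = node m'" using mm(3) by (auto simp: prefix_def)
    then show "m = m'" by (simp add: node_inject)
  qed
  ultimately show False using assms(2) finite_imageD by blast
qed

lemma linear_nth_limit:
  assumes "linear_nodes A" "m \<in> A" "n < length (node m)"
  shows "branch_limit A n = node m ! n"
proof -
  let ?m = "LEAST m. m \<in> A \<and> n < length (node m)"
  have "?m \<in> A \<and> n < length (node ?m)"
    by (rule LeastI[where P = "\<lambda>m. m \<in> A \<and> n < length (node m)"]) (use assms in auto)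
  then have "prefix (node m) (node ?m) \<or> prefix (node ?m) (node m)" "n < length (node ?m)"
    using assms(1,2) unfolding linear_nodes_def by auto
  then show ?thesis
    using assms(3) by (auto simp: branch_limit_def prefix_def nth_append)
qed

lemma linear_subset_branch:
  assumes "linear_nodes A" shows "A \<subseteq> branch (branch_limit A)"
proof
  fix m assume "m \<in> A"
  then show "m \<in> branch (branch_limit A)"
    unfolding branch_def using linear_nth_limit[OF assms \<open>m \<in> A\<close>] by (auto intro!: nth_equalityI)
qed

lemma linear_limit_eq:
  assumes "linear_nodes A" "infinite (A \<inter> branch x)"
  shows "branch_limit A = x"
proof
  fix n
  have "linear_nodes (A \<inter> branch x)" using assms(1) by (rule linear_nodes_subset) auto
  from linear_unbounded[OF this assms(2)] obtain m where "m \<in> A" "m \<in> branch x" "n < length (node m)"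
    by auto
  then show "branch_limit A n = x n"
    using linear_nth_limit[OF assms(1)] branch_nth by simp
qed

text \<open>An infinite chain in the ideal meets one of finitely many branches in an infinite set,
  and its limit is then the point of that branch.\<close>

lemma linear_in_ideal_iff:
  assumes "linear_nodes A"
  shows "A \<in> branch_ideal X \<longleftrightarrow> finite A \<or> branch_limit A \<in> X"
proof
  assume "A \<in> branch_ideal X"
  then obtain E B where EB: "finite E" "finite B" "B \<subseteq> X" "A \<subseteq> E \<union> (\<Union>x\<in>B. branch x)"
    by (rule branch_idealE)
  show "finite A \<or> branch_limit A \<in> X"
  proof (rule ccontr)
    assume n: "\<not> ?thesis"
    have "finite (A \<inter> branch x)" if "x \<in> B" for x
      using linear_limit_eq[OF assms, of x] n EB(3) that by blast
    then have "finite (E \<union> (\<Union>x\<in>B. A \<inter> branch x))"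
      using EB(1,2) by (intro finite_UnI finite_UN_I)
    moreover have "A \<subseteq> E \<union> (\<Union>x\<in>B. A \<inter> branch x)" using EB(4) by blast
    ultimately show False using n finite_subset by blast
  qed
next
  assume "finite A \<or> branch_limit A \<in> X"
  then show "A \<in> branch_ideal X"
  proof
    assume "branch_limit A \<in> X"
    then show ?thesis
      using linear_subset_branch[OF assms] by (intro branch_idealI[of "{}" "{branch_limit A}"]) auto
  qed (rule branch_ideal_finite)
qed

lemma list_encode_in_branch: "list_encode (map x [0..<n]) \<in> branch x"
  by (simp add: branch_def node_def)

lemma infinite_branch: "infinite (branch x)"
proof -
  have "inj (\<lambda>n. list_encode (map x [0..<n]))"
  proof (rule injI)
    fix m n assume "list_encode (map x [0..<m]) = list_encode (map x [0..<n])"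
    then have "map x [0..<m] = map x [0..<n]" by (simp only: list_encode_eq)
    from arg_cong[OF this, of length] show "m = n" by simp
  qed
  then have "infinite (range (\<lambda>n. list_encode (map x [0..<n])))" by (rule range_inj_infinite)
  moreover have "range (\<lambda>n. list_encode (map x [0..<n])) \<subseteq> branch x" using list_encode_in_branch by blast
  ultimately show ?thesis using finite_subset by blast
qed

lemma branch_in_ideal_iff: "branch x \<in> branch_ideal X \<longleftrightarrow> x \<in> X"
  using linear_in_ideal_iff[OF linear_branch, of x X] linear_limit_eq[OF linear_branch, of x x]
    infinite_branch[of x] by simp

text \<open>A branch contains only one sequence of length 1, so finitely many branches and a finite
  set cannot cover all of these.\<close>

lemma UNIV_notin_branch_ideal: "UNIV \<notin> branch_ideal X"
proof
  assume "UNIV \<in> branch_ideal X"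
  then obtain E B where EB: "finite E" "finite B" "UNIV \<subseteq> E \<union> (\<Union>x\<in>B. branch x)"
    by (elim branch_idealE)
  have "range (\<lambda>i. list_encode [i]) \<subseteq> E \<union> (\<lambda>x. list_encode [x 0]) ` B"
  proof
    fix m assume "m \<in> range (\<lambda>i. list_encode [i])"
    then obtain i where m: "m = list_encode [i]" by blast
    have "m \<in> E \<or> (\<exists>x\<in>B. m \<in> branch x)" using EB(3) by blast
    then show "m \<in> E \<union> (\<lambda>x. list_encode [x 0]) ` B"
    proof
      assume "\<exists>x\<in>B. m \<in> branch x"
      then obtain x where x: "x \<in> B" "m \<in> branch x" by blast
      then have "i = x 0" by (simp add: m branch_def node_def)
      then show ?thesis using x m by blast
    qed simp
  qed
  moreover have "inj (\<lambda>i. list_encode [i])" by (rule injI) (simp only: list_encode_eq list.inject)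
  ultimately show False
    using EB(1,2) finite_subset range_inj_infinite by (metis finite_UnI finite_imageI)
qed

definition branch_filter :: "(nat \<Rightarrow> nat) set \<Rightarrow> nat set set" where
  "branch_filter X = {x. - x \<in> branch_ideal X}"

lemma omega_filter_branch_filter: "omega_filter (branch_filter X)"
  unfolding omega_filter_def branch_filter_def mem_Collect_eq
proof (intro conjI allI impI)
  show "- {} \<notin> branch_ideal X" using UNIV_notin_branch_ideal by simp
  show "- UNIV \<in> branch_ideal X" using branch_ideal_finite by simp
  show "- y \<in> branch_ideal X" if "- x \<in> branch_ideal X" "finite (sym_diff x y)" for x y
    by (rule branch_ideal_subset[OF branch_ideal_Un[OF that(1) branch_ideal_finite[OF that(2)]]]) auto
  show "- y \<in> branch_ideal X" if "- x \<in> branch_ideal X" "x \<subseteq> y" for x y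
    using that(1) by (rule branch_ideal_subset) (use that(2) in auto)
  show "- (x \<inter> y) \<in> branch_ideal X" if "- x \<in> branch_ideal X" "- y \<in> branch_ideal X" for x y
    using branch_ideal_Un[OF that] by simp
qed

section \<open>Wadge equivalence of the filter and the given set\<close>

section \<open>The complexity of the ideal\<close>

text \<open>A point of the Baire space stands for the set of its zeros. For a characteristic
  function this is the complement, which turns the filter into the ideal.\<close>

definition zeros :: "(nat \<Rightarrow> nat) \<Rightarrow> nat set" where "zeros y = {n. y n = 0}"

lemma mem_zeros_agree: "agree (Suc m) y y' \<Longrightarrow> m \<in> zeros y \<longleftrightarrow> m \<in> zeros y'"
  by (simp add: agree_def zeros_def)

definition confined :: "nat set \<Rightarrow> nat list set \<Rightarrow> (nat \<Rightarrow> nat) set" where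
  "confined E T = {y. zeros y - E \<subseteq> (\<Union>s\<in>T. {m. prefix s (node m)}) \<and>
     (\<forall>s\<in>T. linear_nodes ((zeros y - E) \<inter> {m. prefix s (node m)}))}"

text \<open>A violation is witnessed by at most two zeros of \<open>y\<close>, hence by an initial
  segment.\<close>

lemma closed_confined: "closed (confined E T)"
  unfolding closed_seq_iff
proof (intro allI impI)
  fix y assume y: "y \<notin> confined E T"
  let ?c = "\<lambda>s. {m. prefix s (node m)}"
  consider m where "m \<in> zeros y - E" "m \<notin> (\<Union>s\<in>T. ?c s)"
    | s where "s \<in> T" "\<not> linear_nodes ((zeros y - E) \<inter> ?c s)"
    using y unfolding confined_def by blast
  then show "\<exists>n. \<forall>y'. agree n y y' \<longrightarrow> y' \<notin> confined E T"
  proof cases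
    case 1
    have "y' \<notin> confined E T" if "agree (Suc m) y y'" for y'
    proof -
      have "m \<in> zeros y' - E" using 1(1) mem_zeros_agree[OF that] by simp
      then show ?thesis using 1(2) unfolding confined_def by blast
    qed
    then show ?thesis by blast
  next
    case 2
    then obtain m n where mn: "m \<in> zeros y - E" "m \<in> ?c s" "n \<in> zeros y - E" "n \<in> ?c s"
      "\<not> (prefix (node m) (node n) \<or> prefix (node n) (node m))"
      unfolding linear_nodes_def by blast
    have "y' \<notin> confined E T" if a: "agree (Suc (max m n)) y y'" for y'
    proof -
      have "m \<in> zeros y' - E" "n \<in> zeros y' - E"
        using mn(1,3) mem_zeros_agree[OF agree_mono[OF a], of m] mem_zeros_agree[OF agree_mono[OF a], of n]
        by simp_all
      then have "\<not> linear_nodes ((zeros y' - E) \<inter> ?c s)"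
        using mn(2,4,5) unfolding linear_nodes_def by blast
      then show ?thesis using 2(1) unfolding confined_def by blast
    qed
    then show ?thesis by blast
  qed
qed

lemma closed_linear_zeros: "closed {y. linear_nodes (zeros y)}"
proof -
  \<comment> \<open>The empty sequence is a stem of every node.\<close>
  have "{y. linear_nodes (zeros y)} = confined {} {[]}" by (auto simp: confined_def)
  then show ?thesis by (simp only: closed_confined)
qed

lemma fsig_finite_zeros: "fsig {y. finite (zeros y)}"
proof -
  have "closed {y. zeros y \<subseteq> {..<n}}" for n
    unfolding closed_seq_iff
  proof (intro allI impI)
    fix y assume "y \<notin> {y. zeros y \<subseteq> {..<n}}"
    then obtain m where m: "m \<in> zeros y" "m \<notin> {..<n}" by blast
    have "y' \<notin> {y. zeros y \<subseteq> {..<n}}" if "agree (Suc m) y y'" for y'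
      using m mem_zeros_agree[OF that] by blast
    then show "\<exists>k. \<forall>y'. agree k y y' \<longrightarrow> y' \<notin> {y. zeros y \<subseteq> {..<n}}" by blast
  qed
  moreover have "{y. finite (zeros y)} = (\<Union>n. {y. zeros y \<subseteq> {..<n}})"
    unfolding finite_nat_iff_bounded by blast
  ultimately show ?thesis
    unfolding fsig_iff by (intro exI[of _ "\<lambda>n. {y. zeros y \<subseteq> {..<n}}"]) simp
qed

text \<open>A zero whose node is longer than \<open>j\<close> determines entry \<open>j\<close> of
  the limit, and it remains a zero nearby.\<close>

lemma continuous_on_branch_limit:
  "continuous_on {y. linear_nodes (zeros y) \<and> infinite (zeros y)} (\<lambda>y. branch_limit (zeros y))"
  unfolding continuous_on_seq_iff
proof (intro ballI allI)
  fix y j assume y: "y \<in> {y. linear_nodes (zeros y) \<and> infinite (zeros y)}"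
  obtain m where m: "m \<in> zeros y" "j < length (node m)"
    using linear_unbounded[of "zeros y" j] y by auto
  have "branch_limit (zeros y') j = branch_limit (zeros y) j"
    if "linear_nodes (zeros y')" "agree (Suc m) y y'" for y'
  proof -
    have "m \<in> zeros y'" using m(1) mem_zeros_agree[OF that(2)] by simp
    then show ?thesis using linear_nth_limit[of _ m j] m y that(1) by simp
  qed
  then show "\<exists>n. \<forall>y'\<in>{y. linear_nodes (zeros y) \<and> infinite (zeros y)}. agree n y y' \<longrightarrow>
      branch_limit (zeros y') j = branch_limit (zeros y) j" by blast
qed

text \<open>At length \<open>n\<close> the points of \<open>B\<close> have separated, so a node on
  one of their branches that extends the stem of a point of \<open>B\<close> lies on the branch of
  that very point.\<close>

lemma ideal_confined:
  assumes "zeros y \<in> branch_ideal X"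
  shows "\<exists>E T. finite E \<and> finite T \<and> y \<in> confined E T"
proof -
  obtain E B where EB: "finite E" "finite B" "B \<subseteq> X" "zeros y \<subseteq> E \<union> (\<Union>x\<in>B. branch x)"
    using assms by (rule branch_idealE)
  \<comment> \<open>The first place of difference; its unspecified value for \<open>x = x'\<close>
    can only enlarge \<open>n\<close>.\<close>
  define d where "d x x' = (LEAST i. x i \<noteq> x' i)" for x x' :: "nat \<Rightarrow> nat"
  define n where "n = Suc (Max (insert 0 ((\<lambda>(x, x'). d x x') ` (B \<times> B))))"
  have n: "x = x'" if "x \<in> B" "x' \<in> B" "map x [0..<n] = map x' [0..<n]" for x x'
  proof (rule ccontr)
    assume "x \<noteq> x'"
    then have "\<exists>i. x i \<noteq> x' i" by auto
    then have "x (d x x') \<noteq> x' (d x x')" unfolding d_def by (rule LeastI_ex)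
    moreover have "d x x' < n"
      unfolding n_def less_Suc_eq_le using EB(2) that(1,2) by (intro Max_ge) auto
    ultimately show False using that(3) by simp
  qed
  \<comment> \<open>Nodes shorter than \<open>n\<close> extend no stem, so they join the exceptional
    set.\<close>
  define E' where "E' = E \<union> (\<Union>x\<in>B. (\<lambda>k. list_encode (map x [0..<k])) ` {..<n})"
  define T where "T = (\<lambda>x. map x [0..<n]) ` B"
  have long: "\<exists>x\<in>B. m \<in> branch x \<and> prefix (map x [0..<n]) (node m)" if m: "m \<in> zeros y - E'" for m
  proof -
    obtain x where x: "x \<in> B" "m \<in> branch x" using m EB(4) unfolding E'_def by blast
    have nd: "node m = map x [0..<length (node m)]" using x(2) by (simp add: branch_def)
    have "n \<le> length (node m)"
    proof (rule ccontr)
      assume l: "\<not> n \<le> length (node m)"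
      have "m = list_encode (map x [0..<length (node m)])"
        using nd by (metis node_def list_decode_inverse)
      then have "m \<in> (\<lambda>k. list_encode (map x [0..<k])) ` {..<n}"
        by (rule image_eqI) (use l in simp)
      then have "m \<in> E'" using x(1) unfolding E'_def by blast
      then show False using m by blast
    qed
    then have "prefix (map x [0..<n]) (node m)" using prefix_upt[of n "length (node m)" x] nd by simp
    then show ?thesis using x by blast
  qed
  have uniq: "m \<in> branch x" if m: "m \<in> zeros y - E'" and x: "x \<in> B" "prefix (map x [0..<n]) (node m)" for m x
  proof -
    obtain x' where x': "x' \<in> B" "m \<in> branch x'" "prefix (map x' [0..<n]) (node m)" using long[OF m] by blast
    have "take n (node m) = map w [0..<n]" if "prefix (map w [0..<n]) (node m)" for w
      using that by (elim prefixE) simp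
    from this[OF x(2)] this[OF x'(3)] have "map x [0..<n] = map x' [0..<n]" by simp
    then show ?thesis using n[OF x(1) x'(1)] x'(2) by simp
  qed
  have "linear_nodes ((zeros y - E') \<inter> {m. prefix s (node m)})" if s: "s \<in> T" for s
  proof -
    obtain x where x: "x \<in> B" "s = map x [0..<n]" using s unfolding T_def by blast
    show ?thesis
      by (rule linear_nodes_subset[OF linear_branch[of x]]) (use uniq[OF _ x(1)] x(2) in auto)
  qed
  moreover have "zeros y - E' \<subseteq> (\<Union>s\<in>T. {m. prefix s (node m)})"
    using long unfolding T_def by blast
  ultimately have "y \<in> confined E' T" unfolding confined_def by blast
  moreover have "finite E'" "finite T" using EB(1,2) by (auto simp: E'_def T_def)
  ultimately show ?thesis by blast
qed

definition code :: "nat set \<Rightarrow> nat \<Rightarrow> nat" where "code x n = (if n \<in> x then 1 else 0)"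

lemma zeros_code: "zeros (code x) = - x"
  by (auto simp: zeros_def code_def)

locale filter_complexity = det_sets +
  fixes X :: "(nat \<Rightarrow> nat) set"
  assumes X: "X \<in> S" and nonselfdual: "\<not> X \<le>\<^sub>W - X"
    and wadge_Int: "A \<le>\<^sub>W X \<Longrightarrow> B \<le>\<^sub>W X \<Longrightarrow> A \<inter> B \<le>\<^sub>W X"
    and wadge_Int_gdel: "A \<le>\<^sub>W X \<Longrightarrow> gdel G \<Longrightarrow> A \<inter> G \<le>\<^sub>W X"
    and wadge_Un_fsig: "A \<le>\<^sub>W X \<Longrightarrow> fsig U \<Longrightarrow> A \<union> U \<le>\<^sub>W X"
    and wadge_SU: "(\<And>n :: nat. A' n \<le>\<^sub>W X) \<Longrightarrow> (\<And>n. fsig (U' n)) \<Longrightarrow> disjoint_family U' \<Longrightarrow>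
      (\<Union>n. A' n \<inter> U' n) \<le>\<^sub>W X"
begin

lemma wadge_gdel: "gdel G \<Longrightarrow> G \<le>\<^sub>W X"
  using wadge_Int_gdel[OF wadge_Un_fsig[OF wadge_le_refl, of UNIV], of G] fsigma_in_topspace[of euclidean]
  by simp

text \<open>On the G-delta set of infinite chains the question is whether the limit lies in
  \<open>X\<close>, and \<open>extend_reduction\<close> makes this a total reduction. The finite
  chains are added as an F-sigma set.\<close>

lemma linear_ideal_complexity:
  "{y. linear_nodes (zeros y) \<and> (finite (zeros y) \<or> branch_limit (zeros y) \<in> X)} \<le>\<^sub>W X"
proof -
  let ?L = "{y. linear_nodes (zeros y)}" and ?F = "{y. finite (zeros y)}"
  let ?G = "{y. linear_nodes (zeros y) \<and> infinite (zeros y)}"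
  have "?G = ?L \<inter> - ?F" by blast
  then have G: "gdel ?G"
    using closed_imp_gdel[OF closed_linear_zeros] fsig_finite_zeros by (simp add: gdelta_in_Int gdel_Compl)
  show ?thesis
  proof (rule extend_reduction[OF G continuous_on_branch_limit X nonselfdual])
    fix f :: "(nat \<Rightarrow> nat) \<Rightarrow> nat \<Rightarrow> nat"
    assume f: "continuous_on UNIV f" "{y \<in> ?G. branch_limit (zeros y) \<in> X} = f -` X \<inter> ?G"
    have "f -` X \<inter> ?G \<le>\<^sub>W X" using wadge_le_vimage[OF f(1)] G by (rule wadge_Int_gdel)
    moreover have "fsig (?L \<inter> ?F)"
      using closed_imp_fsig[OF closed_linear_zeros] fsig_finite_zeros by (rule fsigma_in_Int)
    ultimately have "(f -` X \<inter> ?G) \<union> (?L \<inter> ?F) \<le>\<^sub>W X" by (rule wadge_Un_fsig)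
    moreover have "(f -` X \<inter> ?G) \<union> (?L \<inter> ?F) =
        {y. linear_nodes (zeros y) \<and> (finite (zeros y) \<or> branch_limit (zeros y) \<in> X)}"
      unfolding f(2)[symmetric] by blast
    ultimately show ?thesis by simp
  qed
qed

text \<open>Off \<open>E\<close> the zeros split into one chain above each stem, and they are in the
  ideal iff each chain is; closure under intersections combines these conditions.\<close>

lemma confined_ideal_complexity:
  assumes "finite E" "finite T"
  shows "{y. zeros y \<in> branch_ideal X} \<inter> confined E T \<le>\<^sub>W X"
proof -
  let ?J = "{y. linear_nodes (zeros y) \<and> (finite (zeros y) \<or> branch_limit (zeros y) \<in> X)}"
  \<comment> \<open>Setting an entry to 1 removes its index from the zeros.\<close>
  define r where "r s y m = (if m \<notin> E \<and> prefix s (node m) then y m else 1 :: nat)" for s y m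
  have zr: "zeros (r s y) = (zeros y - E) \<inter> {m. prefix s (node m)}" for s y
    by (auto simp: zeros_def r_def)
  have cr: "continuous_on UNIV (r s)" for s
    unfolding continuous_on_seq_iff
  proof (intro ballI allI)
    fix y j
    have "r s y' j = r s y j" if "agree (Suc j) y y'" for y' using that by (simp add: r_def agree_def)
    then show "\<exists>n. \<forall>y'\<in>UNIV. agree n y y' \<longrightarrow> r s y' j = r s y j" by blast
  qed
  have "(\<Inter>s\<in>T. r s -` ?J) \<le>\<^sub>W X"
    using assms(2)
  proof (induction T rule: finite_induct)
    case empty
    show ?case using wadge_gdel[OF gdel_UNIV] by simp
  next
    case (insert s T)
    have "r s -` ?J \<le>\<^sub>W X"
      using wadge_le_vimage[OF cr] linear_ideal_complexity by (rule wadge_le_trans)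
    then have "r s -` ?J \<inter> (\<Inter>s\<in>T. r s -` ?J) \<le>\<^sub>W X" using insert.IH by (rule wadge_Int)
    then show ?case by (simp only: INF_insert)
  qed
  then have "(\<Inter>s\<in>T. r s -` ?J) \<inter> confined E T \<le>\<^sub>W X"
    by (rule wadge_Int_gdel) (rule closed_imp_gdel[OF closed_confined])
  moreover have "y \<in> (\<Inter>s\<in>T. r s -` ?J) \<longleftrightarrow> zeros y \<in> branch_ideal X" if y: "y \<in> confined E T" for y
  proof -
    have lin: "linear_nodes (zeros (r s y))" if "s \<in> T" for s
      using y that unfolding confined_def zr by blast
    have J: "y \<in> r s -` ?J \<longleftrightarrow> zeros (r s y) \<in> branch_ideal X" if "s \<in> T" for s
      using linear_in_ideal_iff[OF lin[OF that]] lin[OF that] by simp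
    have cover: "zeros y \<subseteq> E \<union> (\<Union>s\<in>T. zeros (r s y))"
      using y unfolding confined_def zr by blast
    show ?thesis
    proof
      assume "y \<in> (\<Inter>s\<in>T. r s -` ?J)"
      then have "(\<Union>s\<in>T. zeros (r s y)) \<in> branch_ideal X"
        using J by (intro branch_ideal_UN assms(2)) blast
      from branch_ideal_subset[OF branch_ideal_Un[OF branch_ideal_finite[OF assms(1)] this] cover]
      show "zeros y \<in> branch_ideal X" .
    next
      assume *: "zeros y \<in> branch_ideal X"
      have "zeros (r s y) \<in> branch_ideal X" for s
        using * by (rule branch_ideal_subset) (auto simp: zr)
      then show "y \<in> (\<Inter>s\<in>T. r s -` ?J)" using J by blast
    qed
  qed
  then have "(\<Inter>s\<in>T. r s -` ?J) \<inter> confined E T = {y. zeros y \<in> branch_ideal X} \<inter> confined E T"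
    by blast
  ultimately show ?thesis by simp
qed

text \<open>Countably many \<open>confined\<close> sets with finite parameters cover the ideal;
  disjointification turns them into the disjoint F-sigma sets that \<open>wadge_SU\<close>
  needs.\<close>

lemma ideal_complexity: "{y. zeros y \<in> branch_ideal X} \<le>\<^sub>W X"
proof -
  let ?I = "{y. zeros y \<in> branch_ideal X}"
  define K where "K n = (case from_nat n of (e, t) \<Rightarrow> confined (set e) (set t))" for n
  have Kc: "closed (K n)" for n by (simp add: K_def closed_confined split: prod.split)
  have KX: "?I \<inter> K n \<le>\<^sub>W X" for n
    using confined_ideal_complexity[of "set e" "set t" for e t] by (simp add: K_def split: prod.split)
  have fs: "fsig (disjointed K n)" for n
  proof -
    have "closed (\<Union>i\<in>{0..<n}. K i)" using Kc by (intro closed_UN) auto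
    then show ?thesis
      unfolding disjointed_def using fsigma_in_diff closed_imp_fsig[OF Kc] closed_imp_gdel by blast
  qed
  have "(\<Union>n. (?I \<inter> K n) \<inter> disjointed K n) \<le>\<^sub>W X"
    by (rule wadge_SU[OF KX fs disjoint_family_disjointed])
  moreover have "?I = (\<Union>n. (?I \<inter> K n) \<inter> disjointed K n)"
  proof -
    have "y \<in> (\<Union>n. K n)" if y: "y \<in> ?I" for y
    proof -
      have "\<exists>E T. finite E \<and> finite T \<and> y \<in> confined E T"
        by (rule ideal_confined) (use y in simp)
      then obtain E T where ET: "finite E" "finite T" "y \<in> confined E T" by (elim exE conjE)
      obtain e where e: "set e = E" using finite_list[OF ET(1)] ..
      obtain t where t: "set t = T" using finite_list[OF ET(2)] ..
      have "y \<in> K (to_nat (e, t))" using ET(3) e t by (simp add: K_def)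
      then show ?thesis by blast
    qed
    then have "?I = ?I \<inter> (\<Union>n. disjointed K n)" unfolding UN_disjointed_eq by blast
    moreover have "disjointed K n \<subseteq> K n" for n by (rule disjointed_subset)
    ultimately show ?thesis by blast
  qed
  ultimately show ?thesis by simp
qed

lemma code_image_filter:
  "code ` branch_filter X = {y. zeros y \<in> branch_ideal X} \<inter> {y. \<forall>n. y n \<le> 1}"
proof (intro equalityI subsetI)
  fix y assume "y \<in> code ` branch_filter X"
  then show "y \<in> {y. zeros y \<in> branch_ideal X} \<inter> {y. \<forall>n. y n \<le> 1}"
    by (auto simp: branch_filter_def zeros_code) (simp add: code_def)
next
  fix y assume y: "y \<in> {y. zeros y \<in> branch_ideal X} \<inter> {y. \<forall>n. y n \<le> 1}"
  have "y = code (- zeros y)"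
  proof
    fix n
    have "y n \<le> 1" using y by simp
    then show "y n = code (- zeros y) n" by (auto simp: code_def zeros_def)
  qed
  moreover have "- zeros y \<in> branch_filter X" using y by (simp add: branch_filter_def)
  ultimately show "y \<in> code ` branch_filter X" by blast
qed

lemma code_filter_le: "code ` branch_filter X \<le>\<^sub>W X"
proof -
  have "closed {y :: nat \<Rightarrow> nat. \<forall>n. y n \<le> 1}"
    unfolding closed_seq_iff
  proof (intro allI impI)
    fix y :: "nat \<Rightarrow> nat" assume "y \<notin> {y. \<forall>n. y n \<le> 1}"
    then obtain n where n: "\<not> y n \<le> 1" by blast
    have "y' \<notin> {y. \<forall>n. y n \<le> 1}" if "agree (Suc n) y y'" for y'
    proof -
      have "y' n = y n" using that by (simp add: agree_def)
      then show ?thesis using n by (metis mem_Collect_eq)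
    qed
    then show "\<exists>n. \<forall>y'. agree n y y' \<longrightarrow> y' \<notin> {y. \<forall>n. y n \<le> 1}" by blast
  qed
  from wadge_Int_gdel[OF ideal_complexity closed_imp_gdel[OF this]]
  show ?thesis unfolding code_image_filter .
qed

text \<open>Whether \<open>j\<close> lies on a branch depends on the first
  \<open>length (node j)\<close> entries of its point, so passing to branches is continuous.\<close>

lemma le_code_filter: "X \<le>\<^sub>W code ` branch_filter X"
proof -
  let ?b = "\<lambda>x. code (- branch x)"
  have "continuous_on UNIV ?b"
    unfolding continuous_on_seq_iff
  proof (intro ballI allI)
    fix x j
    have "?b x' j = ?b x j" if "agree (length (node j)) x x'" for x'
    proof -
      have "map x [0..<length (node j)] = map x' [0..<length (node j)]"
        using that by (simp only: map_upt_eq_iff_agree)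
      then show ?thesis by (simp add: code_def branch_def del: map_eq_conv)
    qed
    then show "\<exists>n. \<forall>x'\<in>UNIV. agree n x x' \<longrightarrow> ?b x' j = ?b x j" by blast
  qed
  moreover have "X = ?b -` (code ` branch_filter X)"
  proof (rule set_eqI)
    fix x
    have "?b x \<in> code ` branch_filter X \<longleftrightarrow> branch x \<in> branch_ideal X"
      unfolding code_image_filter by (simp add: zeros_code) (simp add: code_def)
    then show "x \<in> X \<longleftrightarrow> x \<in> ?b -` (code ` branch_filter X)" by (simp add: branch_in_ideal_iff)
  qed
  ultimately show ?thesis unfolding wadge_le_def by blast
qed

end

section \<open>Filters as zero-dimensional spaces\<close>

section \<open>The space of a filter\<close>

lemma second_countable_baire: "second_countable baire"
proof -
  obtain \<B> :: "(nat \<Rightarrow> nat) set set" where \<B>: "countable \<B>" "topological_basis \<B>"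
    using ex_countable_basis by blast
  show ?thesis
    unfolding second_countable_def baire_eq_euclidean open_openin[symmetric]
  proof (intro exI[of _ \<B>] conjI allI impI ballI)
    show "open V" if "V \<in> \<B>" for V using topological_basis_open[OF \<B>(2) that] .
    show "\<exists>V\<in>\<B>. x \<in> V \<and> V \<subseteq> U" if "open U \<and> x \<in> U" for U x
      using topological_basisE[OF \<B>(2), of U x] that by metis
  qed (rule \<B>(1))
qed

lemma metrizable_baire: "metrizable_space baire"
  unfolding baire_def metrizable_space_product_topology by simp

lemma topspace_baire [simp]: "topspace baire = UNIV"
  by (simp add: baire_eq_euclidean)

lemma sm_space_subtopology_baire: "sm_space (subtopology baire A)"
  unfolding sm_space_def
  using second_countable_baire metrizable_baire
  by (simp add: metrizable_space_subtopology second_countable_imp_separable_space second_countable_subtopology)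

lemma topspace_filter_space: "topspace (filter_space \<F>) = \<F>"
  by (auto simp: filter_space_def topspace_pullback_topology cantor_def)

lemma continuous_map_code: "continuous_map (filter_space \<F>) baire code"
  unfolding baire_def continuous_map_componentwise_UNIV
proof
  fix n
  have "continuous_map cantor (discrete_topology UNIV) (\<lambda>c. c n)"
    unfolding cantor_def by (rule continuous_map_product_projection) simp
  moreover have "continuous_map (discrete_topology UNIV) (discrete_topology UNIV) (\<lambda>b. if b then 1 else 0 :: nat)"
    by simp
  ultimately have "continuous_map cantor (discrete_topology UNIV) ((\<lambda>b. if b then 1 else 0 :: nat) \<circ> (\<lambda>c. c n))"
    by (rule continuous_map_compose)
  then have "continuous_map (filter_space \<F>) (discrete_topology UNIV)
      (((\<lambda>b. if b then 1 else 0 :: nat) \<circ> (\<lambda>c. c n)) \<circ> (\<lambda>x n. n \<in> x))"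
    unfolding filter_space_def by (rule continuous_map_pullback)
  then show "continuous_map (filter_space \<F>) (discrete_topology UNIV) (\<lambda>x. code x n)"
    by (simp add: code_def o_def)
qed

lemma embedding_code: "embedding_map (filter_space \<F>) baire code"
proof -
  define g where "g y = {n. y n \<noteq> 0}" for y :: "nat \<Rightarrow> nat"
  let ?Y = "subtopology baire (code ` \<F>)"
  have inv: "g (code x) = x" for x by (auto simp: g_def code_def)
  have "continuous_map baire cantor (\<lambda>y n. y n \<noteq> 0)"
    unfolding cantor_def continuous_map_componentwise_UNIV
  proof
    fix n
    have "continuous_map baire (discrete_topology UNIV) (\<lambda>y. y n)"
      unfolding baire_def by (rule continuous_map_product_projection) simp
    moreover have "continuous_map (discrete_topology UNIV) (discrete_topology UNIV) (\<lambda>k. k \<noteq> (0::nat))"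
      by simp
    ultimately have "continuous_map baire (discrete_topology UNIV) ((\<lambda>k. k \<noteq> (0::nat)) \<circ> (\<lambda>y. y n))"
      by (rule continuous_map_compose)
    then show "continuous_map baire (discrete_topology UNIV) (\<lambda>y. y n \<noteq> 0)" by (simp add: o_def)
  qed
  then have "continuous_map ?Y cantor ((\<lambda>x n. n \<in> x) \<circ> g)"
    by (simp add: g_def o_def continuous_map_from_subtopology)
  then have "continuous_map ?Y (filter_space \<F>) g"
    unfolding filter_space_def by (rule continuous_map_pullback') (use inv in auto)
  moreover have "continuous_map (filter_space \<F>) ?Y code"
    using continuous_map_code by (intro continuous_map_into_subtopology) (auto simp: topspace_filter_space)
  ultimately have "homeomorphic_maps (filter_space \<F>) ?Y code g"
    unfolding homeomorphic_maps_def by (auto simp: inv)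
  then show ?thesis
    unfolding embedding_map_def topspace_filter_space by (rule homeomorphic_maps_imp_map)
qed

text \<open>The base consists of all clopen sets; among them are the preimages under
  \<open>code\<close> of basic neighbourhoods, which suffice.\<close>

lemma zero_dimensional_filter_space:
  assumes "\<F> \<noteq> {}" shows "zero_dimensional (filter_space \<F>)"
proof -
  let ?X = "filter_space \<F>" and ?Y = "subtopology baire (code ` \<F>)"
  have hom: "homeomorphic_map ?X ?Y code"
    using embedding_code[of \<F>] unfolding embedding_map_def topspace_filter_space .
  then have "?X homeomorphic_space ?Y" by (rule homeomorphic_map_imp_homeomorphic_space)
  then have "sm_space ?X"
    using sm_space_subtopology_baire[of "code ` \<F>"]
    by (simp add: sm_space_def homeomorphic_separable_space homeomorphic_metrizable_space)
  moreover have "openin ?X = arbitrary union_of (\<lambda>U. U \<in> {U. openin ?X U \<and> closedin ?X U})"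
  proof (rule ext)
    fix U
    have "\<exists>V. (openin ?X V \<and> closedin ?X V) \<and> x \<in> V \<and> V \<subseteq> U" if U: "openin ?X U" and x: "x \<in> U" for x
    proof -
      have sub: "U \<subseteq> \<F>" using openin_subset[OF U] by (simp add: topspace_filter_space)
      have "openin ?Y (code ` U)"
        using homeomorphic_imp_open_map[OF hom] U by (simp add: open_map_def)
      then have "\<exists>W. open W \<and> code ` U = W \<inter> code ` \<F>"
        by (simp add: openin_subtopology baire_eq_euclidean)
      then obtain W where W: "open W" "code ` U = W \<inter> code ` \<F>" by (elim exE conjE)
      have "code x \<in> W" using W(2) x by blast
      then obtain n where n: "\<And>y. agree n (code x) y \<Longrightarrow> y \<in> W" using open_seqE[OF W(1)] by metis
      let ?C = "{y. agree n (code x) y}"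
      have "closed ?C"
        unfolding closed_seq_iff mem_Collect_eq by (meson agree_sym agree_trans)
      then have cl: "openin baire ?C" "closedin baire ?C"
        using open_agree[of n "code x"] by (simp_all add: baire_eq_euclidean)
      let ?V = "{x' \<in> topspace ?X. code x' \<in> ?C}"
      have "openin ?X ?V" "closedin ?X ?V"
        using openin_continuous_map_preimage[OF continuous_map_code cl(1)]
          closedin_continuous_map_preimage[OF continuous_map_code cl(2)] by simp_all
      moreover have "x \<in> ?V" using x sub by (auto simp: topspace_filter_space)
      moreover have "?V \<subseteq> U"
      proof
        fix x' assume "x' \<in> ?V"
        then have "code x' \<in> code ` U" using n W(2) by (auto simp: topspace_filter_space)
        then obtain u where "u \<in> U" "code x' = code u" by blast
        moreover have "inj code" by (rule injI) (metis zeros_code double_compl)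
        ultimately show "x' \<in> U" by (metis injD)
      qed
      ultimately show ?thesis by blast
    qed
    moreover have "openin ?X U" if "\<forall>x\<in>U. \<exists>V. (openin ?X V \<and> closedin ?X V) \<and> x \<in> V \<and> V \<subseteq> U"
      using that by (subst openin_subopen) blast
    ultimately show "openin ?X U = (arbitrary union_of (\<lambda>U. U \<in> {U. openin ?X U \<and> closedin ?X U})) U"
      unfolding arbitrary_union_of_alt mem_Collect_eq by blast
  qed
  ultimately show ?thesis
    unfolding zero_dimensional_def using assms topspace_filter_space[of \<F>]
    by (intro conjI exI[of _ "{U. openin ?X U \<and> closedin ?X U}"]) auto
qed

section \<open>Finite differences of F-sigma sets\<close>

lemma mem_D_omega: "x \<in> D_omega A \<longleftrightarrow> (\<exists>m. odd m \<and> x \<in> A m \<and> x \<notin> (\<Union>k<m. A k))"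
  unfolding D_omega_def by blast

text \<open>The sequence \<open>U\<close> exhausts the space at the finite stage \<open>N\<close>,
  so every point has a least index, whose parity decides membership.\<close>

lemma piecewise_empty_differences:
  assumes "A \<in> piecewise {}"
  shows "\<exists>U N. (\<forall>m. fsig (U m)) \<and> U N = UNIV \<and> A = D_omega U"
  using assms
proof induction
  case (base G k)
  \<comment> \<open>Every point enters at index 0, which is even.\<close>
  have "{z \<in> G. k z \<in> {}} = D_omega (\<lambda>_. UNIV)"
    by (auto simp: D_omega_def lessThan_empty_iff)
  then show ?case by (intro exI[of _ "\<lambda>_. UNIV"]) (simp add: fsigma_in_topspace[of euclidean, simplified])
next
  case (compl A)
  then obtain U N where U: "\<forall>m. fsig (U m)" "U N = UNIV" "A = D_omega U" by (elim exE conjE)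
  \<comment> \<open>Putting the empty set in front shifts all indices by one and changes their
    parity.\<close>
  define V where "V = case_nat {} U"
  have "- A = D_omega V"
  proof (rule set_eqI)
    fix x
    define l where "l = (LEAST m. x \<in> U m)"
    have l: "x \<in> U l" unfolding l_def by (rule LeastI[of _ N]) (simp add: U(2))
    have least: "x \<in> U m \<and> x \<notin> (\<Union>k<m. U k) \<longleftrightarrow> m = l" for m
    proof
      assume m: "x \<in> U m \<and> x \<notin> (\<Union>k<m. U k)"
      then have "\<not> l < m" using l by blast
      moreover have "\<not> m < l" using m not_less_Least[of m "\<lambda>m. x \<in> U m"] unfolding l_def by blast
      ultimately show "m = l" by simp
    next
      assume "m = l"
      moreover have "x \<notin> U k" if "k < l" for k
        using that not_less_Least[of k "\<lambda>m. x \<in> U m"] unfolding l_def by blast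
      ultimately show "x \<in> U m \<and> x \<notin> (\<Union>k<m. U k)" using l by blast
    qed
    have "x \<in> A \<longleftrightarrow> odd l" unfolding U(3) mem_D_omega least by simp
    moreover have "x \<in> D_omega V \<longleftrightarrow> even l"
    proof -
      have V: "x \<in> V (Suc m) \<and> x \<notin> (\<Union>k<Suc m. V k) \<longleftrightarrow> m = l" for m
      proof -
        have "(\<Union>k<Suc m. V k) = (\<Union>k<m. U k)"
          by (simp add: V_def lessThan_Suc_eq_insert_0 image_image)
        then show ?thesis using least by (simp add: V_def)
      qed
      have "x \<in> D_omega V \<longleftrightarrow> (\<exists>m. odd (Suc m) \<and> x \<in> V (Suc m) \<and> x \<notin> (\<Union>k<Suc m. V k))"
        unfolding mem_D_omega by (metis even_zero not0_implies_Suc)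
      then show ?thesis unfolding V by simp
    qed
    ultimately show "x \<in> - A \<longleftrightarrow> x \<in> D_omega V" by simp
  qed
  moreover have "\<forall>m. fsig (V m)" using U(1) by (auto simp: V_def split: nat.split)
  moreover have "V (Suc N) = UNIV" using U(2) by (simp add: V_def)
  ultimately show ?case by blast
next
  case (int A G)
  then obtain U N where U: "\<forall>m. fsig (U m)" "U N = UNIV" "A = D_omega U" by (elim exE conjE)
  \<comment> \<open>Points outside \<open>G\<close> now enter at the even index 0 and are
    discarded.\<close>
  have "A \<inter> G = D_omega (\<lambda>m. U m \<union> - G)"
  proof (rule set_eqI)
    fix x
    have "x \<in> U m \<union> - G \<and> x \<notin> (\<Union>k<m. U k \<union> - G) \<longleftrightarrow> x \<in> G \<and> x \<in> U m \<and> x \<notin> (\<Union>k<m. U k)"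
      if "odd m" for m
      using odd_pos[OF that] by blast
    then have "x \<in> D_omega (\<lambda>m. U m \<union> - G) \<longleftrightarrow> (\<exists>m. odd m \<and> x \<in> G \<and> x \<in> U m \<and> x \<notin> (\<Union>k<m. U k))"
      unfolding mem_D_omega by (intro ex_cong1) (rule conj_cong[OF refl])
    also have "\<dots> \<longleftrightarrow> x \<in> A \<inter> G" unfolding U(3) Int_iff mem_D_omega by blast
    finally show "x \<in> A \<inter> G \<longleftrightarrow> x \<in> D_omega (\<lambda>m. U m \<union> - G)" by (rule sym)
  qed
  moreover have "\<forall>m. fsig (U m \<union> - G)" using U(1) int(2) by (simp add: fsigma_in_Un fsig_Compl)
  moreover have "U N \<union> - G = UNIV" using U(2) by simp
  ultimately show ?case by (intro exI[of _ "\<lambda>m. U m \<union> - G"] exI[of _ N]) simp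
qed

lemma piecewise_empty_ambiguous:
  assumes "A \<in> piecewise {}" shows "A \<in> ambiguous baire (D_omega_sigma02 baire)"
proof -
  have D: "B \<in> D_omega_sigma02 baire" if B: "B \<in> piecewise {}" for B
  proof -
    obtain U where "\<forall>m. fsig (U m)" "B = D_omega U" using piecewise_empty_differences[OF B] by blast
    then show ?thesis
      unfolding D_omega_sigma02_def sigma02_def baire_eq_euclidean by auto
  qed
  have "A = UNIV - (- A)" by blast
  then show ?thesis
    unfolding ambiguous_def dual_class_def
    using D[OF assms] D[OF piecewise.compl[OF assms]] by (auto simp: baire_eq_euclidean)
qed

section \<open>From pointclasses and good Wadge classes to the closure properties\<close>

lemma borel_algebra_baire: "borel_algebra baire = borel"
  by (simp add: borel_algebra_def borel_def baire_eq_euclidean)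

lemma det_sets_nice_pointclass:
  assumes nice: "nice_pointclass \<Sigma>" and det: "Det (\<Sigma> baire)"
  shows "det_sets (\<Sigma> baire)"
proof -
  have sm: "sm_space baire" using sm_space_subtopology_baire[of UNIV] by simp
  have b: "borel_sets baire \<subseteq> \<Sigma> baire" and a: "algebra (topspace baire) (\<Sigma> baire)"
    and p: "f \<in> borel_algebra baire \<rightarrow>\<^sub>M borel_algebra baire \<Longrightarrow> B \<in> \<Sigma> baire \<Longrightarrow> preim baire f B \<in> \<Sigma> baire" for f B
    using nice sm unfolding nice_pointclass_def by blast+
  interpret algebra UNIV "\<Sigma> baire" using a by (simp add: baire_eq_euclidean)
  show ?thesis
  proof
    show "- A \<in> \<Sigma> baire" if "A \<in> \<Sigma> baire" for A
      using compl_sets[OF that] by (simp add: Compl_eq_Diff_UNIV)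
    show "A \<inter> B \<in> \<Sigma> baire" if "A \<in> \<Sigma> baire" "B \<in> \<Sigma> baire" for A B using that by (rule Int)
    show "A \<in> \<Sigma> baire" if "A \<in> sets borel" for A using b that by (auto simp: borel_algebra_baire)
    show "f -` A \<in> \<Sigma> baire" if "f \<in> borel_measurable borel" "A \<in> \<Sigma> baire" for f A
      using p[unfolded borel_algebra_baire, of f A] that by (simp add: vimage_def)
    show "determined A" if "A \<in> \<Sigma> baire" for A using det that by (simp add: Det_def)
  qed
qed

lemma wadge_down_baire: "wadge_down baire A = {B. B \<le>\<^sub>W A}"
  unfolding wadge_down_def wadge_le_def continuous_map_baire_iff
  by (auto simp: baire_eq_euclidean vimage_def)

theorem theorem7p3:
  fixes \<Sigma> :: pointclass and \<Gamma> :: "(nat \<Rightarrow> nat) set set"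
  assumes "nice_pointclass \<Sigma>"
    and "Det (\<Sigma> baire)"
    and "\<Gamma> \<subseteq> \<Sigma> baire"
    and "good_wadge_class baire \<Gamma>"
    and "closed_under_squares \<Gamma> baire"
    and "closed_under_SU1 baire \<Gamma>"
  shows "\<exists>\<F>. omega_filter \<F> \<and> has_exact_complexity (filter_space \<F>) \<Gamma>"
proof -
  interpret det_sets "\<Sigma> baire" using assms(1,2) by (rule det_sets_nice_pointclass)
  have "\<exists>X \<subseteq> topspace baire. \<Gamma> = {B. B \<le>\<^sub>W X}"
    using assms(4) by (simp only: good_wadge_class_def wadge_class_def wadge_down_baire)
  then obtain X where \<Gamma>: "\<Gamma> = {B. B \<le>\<^sub>W X}" by (elim exE conjE)
  have X: "X \<in> \<Sigma> baire" using assms(3) \<Gamma> wadge_le_refl by blast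
  have nsd: "\<not> X \<le>\<^sub>W - X"
  proof
    assume "X \<le>\<^sub>W - X"
    then have "- X \<le>\<^sub>W X" by (simp only: wadge_le_Compl_swap)
    have "B \<in> dual_class baire \<Gamma> \<longleftrightarrow> B \<in> \<Gamma>" for B
    proof -
      have "B \<in> dual_class baire \<Gamma> \<longleftrightarrow> - B \<le>\<^sub>W X"
        unfolding dual_class_def \<Gamma> by (auto simp: Compl_eq_Diff_UNIV[symmetric] intro: exI[of _ "- B"])
      also have "\<dots> \<longleftrightarrow> B \<le>\<^sub>W X"
        using wadge_le_trans[OF _ \<open>X \<le>\<^sub>W - X\<close>] wadge_le_trans[OF _ \<open>- X \<le>\<^sub>W X\<close>]
        unfolding wadge_le_Compl_swap by blast
      finally show ?thesis by (simp add: \<Gamma>)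
    qed
    then have "\<Gamma> = dual_class baire \<Gamma>" by blast
    then show False using assms(4) unfolding good_wadge_class_def selfdual_def by simp
  qed
  \<comment> \<open>Otherwise \<open>- X\<close> would be an ambiguous difference and belong to
    \<open>\<Gamma>\<close> by goodness, making \<open>X\<close> selfdual.\<close>
  have X_not: "X \<notin> piecewise {}"
  proof
    assume "X \<in> piecewise {}"
    then have "- X \<in> ambiguous baire (D_omega_sigma02 baire)"
      by (intro piecewise_empty_ambiguous piecewise.compl)
    then have "- X \<le>\<^sub>W X" using assms(4) \<Gamma> unfolding good_wadge_class_def by blast
    then show False using nsd by (simp only: wadge_le_Compl_swap)
  qed
  have PU: "(\<Union>n. A n \<inter> V n) \<le>\<^sub>W X"
    if "\<And>n :: nat. A n \<le>\<^sub>W X" "\<And>n. fsig (V n) \<and> gdel (V n)" "disjoint_family V" "(\<Union>n. V n) = UNIV" for A V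
  proof -
    have "(\<Union>n. A n \<inter> V n) \<in> PU1 baire \<Gamma>"
      unfolding PU1_def delta02_def baire_eq_euclidean mem_Collect_eq
      by (intro exI[of _ A] exI[of _ V]) (use that \<Gamma> in auto)
    then show ?thesis using assms(4) \<Gamma> unfolding good_wadge_class_def level_ge_1_def by simp
  qed
  \<comment> \<open>The intersection is the preimage of the square of \<open>X\<close> under the
    pair of the two reductions.\<close>
  have sq: "A \<inter> B \<le>\<^sub>W X" if "A \<le>\<^sub>W X" "B \<le>\<^sub>W X" for A B
  proof -
    from that(1) obtain f where f: "continuous_on UNIV f" "A = f -` X"
      unfolding wadge_le_def by (elim exE conjE)
    from that(2) obtain g where g: "continuous_on UNIV g" "B = g -` X"
      unfolding wadge_le_def by (elim exE conjE)
    have "X \<in> relativize \<Gamma> baire"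
      unfolding relativize_def \<Gamma> continuous_map_baire_iff
      using wadge_le_vimage by (simp add: vimage_def)
    then have "X \<times> X \<in> relativize \<Gamma> (prod_topology baire baire)"
      using assms(5) unfolding closed_under_squares_def by blast
    moreover have "continuous_map baire (prod_topology baire baire) (\<lambda>z. (f z, g z))"
      using f(1) g(1) by (simp add: continuous_map_pairwise o_def continuous_map_baire_iff)
    ultimately have "preim baire (\<lambda>z. (f z, g z)) (X \<times> X) \<in> \<Gamma>" unfolding relativize_def by blast
    moreover have "preim baire (\<lambda>z. (f z, g z)) (X \<times> X) = A \<inter> B"
      using f(2) g(2) by auto
    ultimately show ?thesis using \<Gamma> by simp
  qed
  have SU: "(\<Union>n. A n \<inter> U n) \<le>\<^sub>W X"
    if "\<And>n :: nat. A n \<le>\<^sub>W X" "\<And>n. fsig (U n)" "disjoint_family U" for A U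
  proof -
    have "(\<Union>n. A n \<inter> U n) \<in> SU1 baire \<Gamma>"
      unfolding SU1_def sigma02_def baire_eq_euclidean mem_Collect_eq
      by (intro exI[of _ A] exI[of _ U]) (use that \<Gamma> in auto)
    then show ?thesis using assms(6) \<Gamma> unfolding closed_under_SU1_def by simp
  qed
  interpret filter_complexity "\<Sigma> baire" X
  proof (unfold_locales, rule X, rule nsd)
    show "A \<inter> B \<le>\<^sub>W X" if "A \<le>\<^sub>W X" "B \<le>\<^sub>W X" for A B using that by (rule sq)
    show "A \<inter> G \<le>\<^sub>W X" if "A \<le>\<^sub>W X" "gdel G" for A G
      using nonselfdual_closure(1)[OF X nsd X_not PU that] .
    show "A \<union> U \<le>\<^sub>W X" if "A \<le>\<^sub>W X" "fsig U" for A U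
      using nonselfdual_closure(2)[OF X nsd X_not PU that] .
    show "(\<Union>n. A n \<inter> U n) \<le>\<^sub>W X"
      if "\<And>n :: nat. A n \<le>\<^sub>W X" "\<And>n. fsig (U n)" "disjoint_family U" for A U
      using that by (rule SU)
  qed
  have "branch_filter X \<noteq> {}"
    using omega_filter_branch_filter[of X] unfolding omega_filter_def by blast
  moreover have "wadge_down baire (code ` branch_filter X) = \<Gamma>"
    unfolding wadge_down_baire \<Gamma> using code_filter_le le_code_filter wadge_le_trans by blast
  ultimately have "has_exact_complexity (filter_space (branch_filter X)) \<Gamma>"
    unfolding has_exact_complexity_def
    using zero_dimensional_filter_space embedding_code topspace_filter_space by metis
  then show ?thesis using omega_filter_branch_filter by blast
qed

end
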